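(* Let $u^*$ and $u_N^*$ be the optimal solutions (optimal controls, i.e. initial conditions) of the full-order strong-constraint 4D-Var problem (FE) and the reduced-order strong-constraint 4D-Var problem (RB), respectively, both defined in the context. The error satisfies $$\|u^*-u_N^*\|_U\;\le\;\Delta_N^u(\mu):=c_1(\mu)+\sqrt{c_1(\mu)^2+c_2(\mu)}\qquad\forall\mu\in\mathcal{D},$$ where $c_1(\mu)$ and $c_2(\mu)$ are given by $$c_1(\mu)=\frac12\left(\|r_u(\cdot;\mu)\|_{U'}+\frac{1}{\sqrt{\alpha_{\rm LB}(\mu)}}R_p\right),\qquad c_2(\mu)=\frac{\sqrt2+1}{\alpha_{\rm LB}(\mu)}R_yR_p+\frac{\gamma_c^2}{2(\alpha_{\rm LB}(\mu))^2}R_y^2 .$$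
   Context: Setting. $\Omega\subset\mathbb{R}^d$ is a bounded Lipschitz domain. $Y_{\rm e}$ is a Hilbert space with $H^1_0(\Omega)\subset Y_{\rm e}\subset H^1(\Omega)$, inner product $(\cdot,\cdot)_Y$ and induced norm $\|\cdot\|_Y$, assumed equivalent to the $H^1(\Omega)$-norm. $U_{\rm e}=L^2(\Omega)$ is the Hilbert space for the control, together with its inner product $(\cdot,\cdot)_U$ and induced norm $\|\cdot\|_U$. $Y\subset Y_{\rm e}$ and $U\subset U_{\rm e}$ are conforming finite element (finite-dimensional) subspaces with the inherited inner products and norms; $Y'$, $U'$ are the dual spaces, with dual norms $\|r\|_{Y'}=\sup_{v\in Y\setminus\{0\}}r(v)/\|v\|_Y$, and similarly for $U'$. $\mathcal{D}\subset\mathbb{R}^P$ is a compact parameter set. $T>0$ is a fixed final time, $K\in\mathbb{N}$, $\tau=T/K$, $\mathbb{K}=\{1,\dots,K\}$. The dependence of states, adjoints and controls on $\mu$ is not written explicitly. Forms. $m(w,v)=(w,v)_{L^2(\Omega)}$ for $w,v\in L^2(\Omega)$. For each $\mu\in\mathcal{D}$, $a(\cdot,\cdot;\mu):Y\times Y\to\mathbb{R}$ is a continuous bilinear form, coercive with $\alpha(\mu)=\inf_{v\in Y\setminus\{0\}}a(v,v;\mu)/\|v\|_Y^2\ge\underline{\alpha}>0$ for all $\mu\in\mathcal{D}$, and affine in the parameter: $a(w,v;\mu)=\sum_{q=1}^{Q_a}\Theta_a^q(\mu)a^q(w,v)$ with continuous $\Theta_a^q:\mathcal{D}\to\mathbb{R}$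 and continuous parameter-independent bilinear forms $a^q$. $f:Y\to\mathbb{R}$ is a continuous linear functional. $D=\mathbb{R}^\ell$ is the observation space with inner product $(\cdot,\cdot)_D$ and norm $\|\cdot\|_D$; $C:Y\to D$ is the continuous linear operator $C\phi=(h_1(\phi),\dots,h_\ell(\phi))^T$ with $h_i\in Y'$, and $\gamma_c=\sup_{v\in Y\setminus\{0\}}\|Cv\|_D/\|v\|_Y$. A positive lower bound $\alpha_{\rm LB}:\mathcal{D}\to\mathbb{R}_+$ is given with $0<\underline{\alpha}\le\alpha_{\rm LB}(\mu)\le\alpha(\mu)$ for all $\mu\in\mathcal{D}$. Data: background state $u_d\in U$ and observations $z_d^k\in D$, $k\in\mathbb{K}$. Full-order problem (FE). For given $\mu\in\mathcal{D}$, minimize $J(y,u;\mu)=\frac12\|u-u_d\|_U^2+\frac\tau2\sum_{k=1}^K\|Cy^k-z_d^k\|_D^2$ over $y\in Y^K$, $u\in U$, subject to $m(y^k,v)+\tau a(y^k,v;\mu)=m(y^{k-1},v)+\tau f(v)$ for all $v\in Y$, $k\in\mathbb{K}$, with initial condition $m(y^0,v)=m(u,v)$ for all $v\in Y$. The necessary and sufficient first-order optimality conditions are: $(y^*,p^*,u^* )\in Y^K\times Y^K\times U$ satisfies - $m(y^{*,k}-y^{*,k-1},\phi)+\tau a(y^{*,k},\phi;\mu)=\tau f(\phi)$ for all $\phi\in Y$, $k\in\mathbb{K}$, and $m(y^{*,0},\phi)=m(u^*,\phi)$ for all $\phi\in Y$; - $m(\varphi,p^{*,k}-p^{*,k+1})+\tau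 a(\varphi,p^{*,k};\mu)=\tau(z_d^k-Cy^{*,k},C\varphi)_D$ for all $\varphi\in Y$, $k\in\mathbb{K}$, with $p^{*,K+1}=0$; - $(u^*-u_d,\psi)_U-m(\psi,p^{*,1})=0$ for all $\psi\in U$. Reduced-order problem (RB). $Y_N\subset Y$ (for state and adjoint) and $U_N^0\subset U$ (for the control) are given linear subspaces (reduced basis spaces). For given $\mu\in\mathcal{D}$, minimize $J(y_N,u_N;\mu)$ over $y_N\in Y_N^K$, $u_N\in U_N^0$ subject to $m(y_N^k,v)+\tau a(y_N^k,v;\mu)=m(y_N^{k-1},v)+\tau f(v)$ for all $v\in Y_N$, $k\in\mathbb{K}$, with initial condition $m(y_N^0,v)=m(u_N,v)$ for all $v\in Y_N$. The optimal solution $(y_N^*,p_N^*,u_N^* )\in Y_N^K\times Y_N^K\times U_N^0$ satisfies the reduced-order optimality system - $m(y_N^{*,k}-y_N^{*,k-1},\phi)+\tau a(y_N^{*,k},\phi;\mu)=\tau f(\phi)$ for all $\phi\in Y_N$, $k\in\mathbb{K}$, and $m(y_N^{*,0},\phi)=m(u_N^*,\phi)$ for all $\phi\in Y_N$; - $m(\varphi,p_N^{*,k}-p_N^{*,k+1})+\tau a(\varphi,p_N^{*,k};\mu)=\tau(z_d^k-Cy_N^{*,k},C\varphi)_D$ for all $\varphi\in Y_N$, $k\in\mathbb{K}$, with $p_N^{*,K+1}=0$; - $(u_N^*-u_d,\psi)_U-m(\psi,p_N^{*,1})=0$ for all $\psi\in U_N^0$. Residuals. For $k\in\mathbb{K}$,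 $\phi,\varphi\in Y$, $\psi\in U$: $r_y^k(\phi;\mu)=f(\phi)-a(y_N^{*,k},\phi;\mu)-\frac1\tau m(y_N^{*,k}-y_N^{*,k-1},\phi)$, $r_p^k(\varphi;\mu)=(z_d^k-Cy_N^{*,k},C\varphi)_D-a(\varphi,p_N^{*,k};\mu)-\frac1\tau m(\varphi,p_N^{*,k}-p_N^{*,k+1})$, $r_u(\psi;\mu)=m(\psi,p_N^{*,1})-(u_N^*-u_d,\psi)_U$. Set $R_y=\big(\tau\sum_{k=1}^K\|r_y^k(\cdot;\mu)\|_{Y'}^2\big)^{1/2}$ and $R_p=\big(\tau\sum_{k=1}^K\|r_p^k(\cdot;\mu)\|_{Y'}^2\big)^{1/2}$.
   Formalization: The reduced initial condition m(y_N^0,φ)=m(u_N^*,φ) is required for all φ in Y, not only in Y_N (e.g. y_N^0=u_N^*, or U_N^0⊂Y_N with y_N^0 in Y_N); otherwise the bound fails, e.g. for Y_N={0}. (·,·)_U is the L² inner product. *)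

theory Defs
  imports "HOL-Analysis.Analysis" "HOL-Library.Function_Algebras"
begin

(* Elements of L2(Omega) and its subspaces are represented by functions on the whole space;
   two functions that agree a.e. on Omega represent the same element.  All forms below are
   continuous with respect to seminorms vanishing exactly on the functions that are 0 a.e. on
   Omega, so they respect this identification; "v = 0 in V" is expressed as "norm of v is 0". *)

global_interpretation fun_space: vector_space "\<lambda>(c::real) (f::'a \<Rightarrow> real). (\<lambda>x. c * f x)"
  by unfold_locales (auto simp: fun_eq_iff algebra_simps)

section \<open>Lipschitz domains and Sobolev spaces\<close>

(* Near every boundary point, Omega is the strict epigraph of a Lipschitz function over the
   hyperplane orthogonal to some unit vector n. *)
definition lipschitz_domain :: "(real^'d) set \<Rightarrow> bool" where
  "lipschitz_domain \<Omega> \<longleftrightarrow> open \<Omega> \<and> connected \<Omega> \<and> \<Omega> \<noteq> {} \<and>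
     (\<forall>x\<in>frontier \<Omega>. \<exists>r>0. \<exists>n \<gamma> L. norm n = 1 \<and> L-lipschitz_on {z. z \<bullet> n = 0} \<gamma> \<and>
        \<Omega> \<inter> ball x r = {z \<in> ball x r. \<gamma> (z - (z \<bullet> n) *\<^sub>R n) < z \<bullet> n})"

abbreviation partial_deriv :: "real^'d \<Rightarrow> (real^'d \<Rightarrow> real) \<Rightarrow> real^'d \<Rightarrow> real" where
  "partial_deriv b f \<equiv> (\<lambda>x. frechet_derivative f (at x) b)"

primrec C_k :: "nat \<Rightarrow> (real^'d \<Rightarrow> real) \<Rightarrow> bool" where
  "C_k 0 f \<longleftrightarrow> continuous_on UNIV f"
| "C_k (Suc k) f \<longleftrightarrow> (\<forall>x. f differentiable at x) \<and> (\<forall>b\<in>Basis. C_k k (partial_deriv b f))"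

definition test_functions :: "(real^'d) set \<Rightarrow> (real^'d \<Rightarrow> real) set" where
  "test_functions \<Omega> = {\<phi>. (\<forall>k. C_k k \<phi>) \<and>
     compact (closure {x. \<phi> x \<noteq> 0}) \<and> closure {x. \<phi> x \<noteq> 0} \<subseteq> \<Omega>}"

definition L2 :: "(real^'d) set \<Rightarrow> (real^'d \<Rightarrow> real) set" where
  "L2 \<Omega> = {f \<in> borel_measurable (lebesgue_on \<Omega>). integrable (lebesgue_on \<Omega>) (\<lambda>x. (f x)\<^sup>2)}"

definition L2_inner :: "(real^'d) set \<Rightarrow> (real^'d \<Rightarrow> real) \<Rightarrow> (real^'d \<Rightarrow> real) \<Rightarrow> real" where
  "L2_inner \<Omega> f g = integral\<^sup>L (lebesgue_on \<Omega>) (\<lambda>x. f x * g x)"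

definition has_weak_partial ::
  "(real^'d) set \<Rightarrow> real^'d \<Rightarrow> (real^'d \<Rightarrow> real) \<Rightarrow> (real^'d \<Rightarrow> real) \<Rightarrow> bool" where
  "has_weak_partial \<Omega> b u g \<longleftrightarrow> g \<in> L2 \<Omega> \<and>
     (\<forall>\<phi>\<in>test_functions \<Omega>. L2_inner \<Omega> u (partial_deriv b \<phi>) = - L2_inner \<Omega> g \<phi>)"

definition H1 :: "(real^'d) set \<Rightarrow> (real^'d \<Rightarrow> real) set" where
  "H1 \<Omega> = {u \<in> L2 \<Omega>. \<forall>b\<in>Basis. \<exists>g. has_weak_partial \<Omega> b u g}"

(* Weak derivatives are unique up to null sets, so the norm does not depend on the choice. *)
definition weak_partial :: "(real^'d) set \<Rightarrow> real^'d \<Rightarrow> (real^'d \<Rightarrow> real) \<Rightarrow> real^'d \<Rightarrow> real" where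
  "weak_partial \<Omega> b u = (SOME g. has_weak_partial \<Omega> b u g)"

definition H1_norm :: "(real^'d) set \<Rightarrow> (real^'d \<Rightarrow> real) \<Rightarrow> real" where
  "H1_norm \<Omega> u = sqrt (L2_inner \<Omega> u u +
     (\<Sum>b\<in>Basis. L2_inner \<Omega> (weak_partial \<Omega> b u) (weak_partial \<Omega> b u)))"

definition H1_0 :: "(real^'d) set \<Rightarrow> (real^'d \<Rightarrow> real) set" where
  "H1_0 \<Omega> = {u \<in> H1 \<Omega>. \<forall>\<epsilon>>0. \<exists>\<phi>\<in>test_functions \<Omega>. H1_norm \<Omega> (u - \<phi>) < \<epsilon>}"

section \<open>Forms on function spaces\<close>

definition ip_norm :: "('v \<Rightarrow> 'v \<Rightarrow> real) \<Rightarrow> 'v \<Rightarrow> real" where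
  "ip_norm ip v = sqrt (ip v v)"

definition linear_form_on :: "('a \<Rightarrow> real) set \<Rightarrow> (('a \<Rightarrow> real) \<Rightarrow> real) \<Rightarrow> bool" where
  "linear_form_on V r \<longleftrightarrow> (\<forall>v\<in>V. \<forall>w\<in>V. r (v + w) = r v + r w) \<and>
     (\<forall>c. \<forall>v\<in>V. r (\<lambda>x. c * v x) = c * r v)"

definition bilinear_form_on ::
  "('a \<Rightarrow> real) set \<Rightarrow> (('a \<Rightarrow> real) \<Rightarrow> ('a \<Rightarrow> real) \<Rightarrow> real) \<Rightarrow> bool" where
  "bilinear_form_on V b \<longleftrightarrow>
     (\<forall>w\<in>V. linear_form_on V (b w)) \<and> (\<forall>v\<in>V. linear_form_on V (\<lambda>w. b w v))"

definition continuous_linear_form ::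
  "('a \<Rightarrow> real) set \<Rightarrow> (('a \<Rightarrow> real) \<Rightarrow> real) \<Rightarrow> (('a \<Rightarrow> real) \<Rightarrow> real) \<Rightarrow> bool" where
  "continuous_linear_form V nrm r \<longleftrightarrow> linear_form_on V r \<and>
     (\<exists>M. \<forall>v\<in>V. \<bar>r v\<bar> \<le> M * nrm v)"

definition continuous_bilinear_form ::
  "('a \<Rightarrow> real) set \<Rightarrow> (('a \<Rightarrow> real) \<Rightarrow> real) \<Rightarrow> (('a \<Rightarrow> real) \<Rightarrow> ('a \<Rightarrow> real) \<Rightarrow> real) \<Rightarrow> bool" where
  "continuous_bilinear_form V nrm b \<longleftrightarrow> bilinear_form_on V b \<and>
     (\<exists>M. \<forall>w\<in>V. \<forall>v\<in>V. \<bar>b w v\<bar> \<le> M * nrm w * nrm v)"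

definition dual_norm ::
  "('a \<Rightarrow> real) set \<Rightarrow> (('a \<Rightarrow> real) \<Rightarrow> real) \<Rightarrow> (('a \<Rightarrow> real) \<Rightarrow> real) \<Rightarrow> real" where
  "dual_norm V nrm r = (SUP v\<in>{v\<in>V. nrm v \<noteq> 0}. r v / nrm v)"

definition coercivity_constant ::
  "('a \<Rightarrow> real) set \<Rightarrow> (('a \<Rightarrow> real) \<Rightarrow> real) \<Rightarrow> (('a \<Rightarrow> real) \<Rightarrow> ('a \<Rightarrow> real) \<Rightarrow> real) \<Rightarrow> real" where
  "coercivity_constant V nrm b = (INF v\<in>{v\<in>V. nrm v \<noteq> 0}. b v v / (nrm v)\<^sup>2)"

definition hilbert_function_space ::
  "(real^'d) set \<Rightarrow> (real^'d \<Rightarrow> real) set \<Rightarrow> ((real^'d \<Rightarrow> real) \<Rightarrow> (real^'d \<Rightarrow> real) \<Rightarrow> real) \<Rightarrow> bool" where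
  "hilbert_function_space \<Omega> V ip \<longleftrightarrow> fun_space.subspace V \<and> bilinear_form_on V ip \<and>
     (\<forall>v\<in>V. \<forall>w\<in>V. ip v w = ip w v) \<and>
     (\<forall>v\<in>V. 0 \<le> ip v v \<and> (ip v v = 0 \<longleftrightarrow> (AE x in lebesgue_on \<Omega>. v x = 0))) \<and>
     (\<forall>s::nat \<Rightarrow> real^'d \<Rightarrow> real. (\<forall>n. s n \<in> V) \<and>
        (\<forall>\<epsilon>>0. \<exists>N. \<forall>m\<ge>N. \<forall>n\<ge>N. ip_norm ip (s m - s n) < \<epsilon>) \<longrightarrow>
        (\<exists>l\<in>V. (\<lambda>n. ip_norm ip (s n - l)) \<longlonglongrightarrow> 0))"

definition finite_dim_space :: "(real^'d) set \<Rightarrow> (real^'d \<Rightarrow> real) set \<Rightarrow> bool" where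
  "finite_dim_space \<Omega> V \<longleftrightarrow> fun_space.subspace V \<and>
     (\<exists>B. finite B \<and> B \<subseteq> V \<and>
        (\<forall>v\<in>V. \<exists>w\<in>fun_space.span B. AE x in lebesgue_on \<Omega>. v x = w x))"

section \<open>Strong-constraint 4D-Var\<close>

(* The unknowns are y 1, ..., y K in W.  The initial state y 0 enters only through
   L2 inner products and is determined by u up to the L2-orthogonal complement of W. *)
definition state_equation ::
  "(real^'d) set \<Rightarrow> ((real^'d \<Rightarrow> real) \<Rightarrow> (real^'d \<Rightarrow> real) \<Rightarrow> real) \<Rightarrow> ((real^'d \<Rightarrow> real) \<Rightarrow> real) \<Rightarrow>
   real \<Rightarrow> nat \<Rightarrow> (real^'d \<Rightarrow> real) set \<Rightarrow> (nat \<Rightarrow> real^'d \<Rightarrow> real) \<Rightarrow> (real^'d \<Rightarrow> real) \<Rightarrow> bool" where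
  "state_equation \<Omega> A f \<tau> K W y u \<longleftrightarrow>
     (\<forall>k\<in>{1..K}. y k \<in> W) \<and>
     (\<forall>k\<in>{1..K}. \<forall>v\<in>W.
        L2_inner \<Omega> (y k) v + \<tau> * A (y k) v = L2_inner \<Omega> (y (k - 1)) v + \<tau> * f v) \<and>
     y 0 \<in> L2 \<Omega> \<and> (\<forall>v\<in>W. L2_inner \<Omega> (y 0) v = L2_inner \<Omega> u v)"

definition cost ::
  "(real^'d) set \<Rightarrow> ((real^'d \<Rightarrow> real) \<Rightarrow> real^'l) \<Rightarrow> (real^'l \<Rightarrow> real^'l \<Rightarrow> real) \<Rightarrow> real \<Rightarrow> nat \<Rightarrow>
   (real^'d \<Rightarrow> real) \<Rightarrow> (nat \<Rightarrow> real^'l) \<Rightarrow> (nat \<Rightarrow> real^'d \<Rightarrow> real) \<Rightarrow> (real^'d \<Rightarrow> real) \<Rightarrow> real" where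
  "cost \<Omega> C ipD \<tau> K ud zd y u =
     1/2 * (ip_norm (L2_inner \<Omega>) (u - ud))\<^sup>2 +
     \<tau>/2 * (\<Sum>k=1..K. (ip_norm ipD (C (y k) - zd k))\<^sup>2)"

(* (y,u) minimizes the cost over states in W^K and controls in V subject to the state equation
   tested with W: the full-order problem is W = Y, V = U, the reduced-order problem is
   W = Y_N, V = U_N. *)
definition optimal_4dvar ::
  "(real^'d) set \<Rightarrow> ((real^'d \<Rightarrow> real) \<Rightarrow> (real^'d \<Rightarrow> real) \<Rightarrow> real) \<Rightarrow> ((real^'d \<Rightarrow> real) \<Rightarrow> real) \<Rightarrow>
   ((real^'d \<Rightarrow> real) \<Rightarrow> real^'l) \<Rightarrow> (real^'l \<Rightarrow> real^'l \<Rightarrow> real) \<Rightarrow> real \<Rightarrow> nat \<Rightarrow>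
   (real^'d \<Rightarrow> real) \<Rightarrow> (nat \<Rightarrow> real^'l) \<Rightarrow> (real^'d \<Rightarrow> real) set \<Rightarrow> (real^'d \<Rightarrow> real) set \<Rightarrow>
   (nat \<Rightarrow> real^'d \<Rightarrow> real) \<Rightarrow> (real^'d \<Rightarrow> real) \<Rightarrow> bool" where
  "optimal_4dvar \<Omega> A f C ipD \<tau> K ud zd W V y u \<longleftrightarrow>
     u \<in> V \<and> state_equation \<Omega> A f \<tau> K W y u \<and>
     (\<forall>y' u'. u' \<in> V \<and> state_equation \<Omega> A f \<tau> K W y' u' \<longrightarrow>
        cost \<Omega> C ipD \<tau> K ud zd y u \<le> cost \<Omega> C ipD \<tau> K ud zd y' u')"

definition optimality_system ::
  "(real^'d) set \<Rightarrow> ((real^'d \<Rightarrow> real) \<Rightarrow> (real^'d \<Rightarrow> real) \<Rightarrow> real) \<Rightarrow> ((real^'d \<Rightarrow> real) \<Rightarrow> real) \<Rightarrow>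
   ((real^'d \<Rightarrow> real) \<Rightarrow> real^'l) \<Rightarrow> (real^'l \<Rightarrow> real^'l \<Rightarrow> real) \<Rightarrow> real \<Rightarrow> nat \<Rightarrow>
   (real^'d \<Rightarrow> real) \<Rightarrow> (nat \<Rightarrow> real^'l) \<Rightarrow> (real^'d \<Rightarrow> real) set \<Rightarrow> (real^'d \<Rightarrow> real) set \<Rightarrow>
   (nat \<Rightarrow> real^'d \<Rightarrow> real) \<Rightarrow> (nat \<Rightarrow> real^'d \<Rightarrow> real) \<Rightarrow> (real^'d \<Rightarrow> real) \<Rightarrow> bool" where
  "optimality_system \<Omega> A f C ipD \<tau> K ud zd W V y p u \<longleftrightarrow>
     u \<in> V \<and> state_equation \<Omega> A f \<tau> K W y u \<and>
     (\<forall>k\<in>{1..K}. p k \<in> W) \<and> p (K + 1) = 0 \<and>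
     (\<forall>k\<in>{1..K}. \<forall>\<phi>\<in>W. L2_inner \<Omega> \<phi> (p k - p (k + 1)) + \<tau> * A \<phi> (p k) =
        \<tau> * ipD (zd k - C (y k)) (C \<phi>)) \<and>
     (\<forall>\<psi>\<in>V. L2_inner \<Omega> (u - ud) \<psi> - L2_inner \<Omega> \<psi> (p 1) = 0)"

end

theory Submission
  imports Defs
begin

text \<open>Let \<open>e = u - uN\<close>, and let \<open>w\<close> be the implicit Euler trajectory in \<open>Y\<close> of the homogeneous
  state equation started at \<open>e\<close>; it exists by a Galerkin argument.  Varying the full-order
  optimum in the direction \<open>(w, e)\<close> replaces the full-order adjoint, so none is constructed.
  Testing the reduced adjoint residual with \<open>w\<close> and summing by parts gives
  \[ \|e\|_U^2 + \tau \sum_k \|C(y^k - y_N^k)\|_D^2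
     = r_u(e) + \tau \sum_k r_p^k(w^k) + \tau \sum_k (C(y^k - y_N^k), C g^k)_D , \]
  where \<open>g = y - yN - w\<close> solves the state equation with right-hand side \<open>ry\<close> and zero initial value.
  The energy estimates bound \<open>w\<close> by \<open>e\<close> and \<open>g\<close> by \<open>Ry\<close>, and Young's inequality absorbs the
  observation term.  The result is a quadratic inequality for the norm of \<open>e\<close>.\<close>

section \<open>Forms on function spaces and the Cauchy-Schwarz inequality\<close>

lemma discriminant_nonneg_quadratic:
  fixes A B C :: real
  assumes C: "0 \<le> C" and nonneg: "\<And>t. 0 \<le> A + 2 * t * B + t\<^sup>2 * C"
  shows "B\<^sup>2 \<le> A * C"
proof (cases "C = 0")
  case True
  have "B = 0"
  proof (rule ccontr)
    assume "B \<noteq> 0"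
    \<comment> \<open>With \<open>C = 0\<close> the polynomial is affine with slope
      \<open>2 * B\<close>; at this \<open>t\<close> it takes the value -1.\<close>
    then show False using nonneg[of "- (A + 1) / (2 * B)"] True by (simp add: field_simps)
  qed
  then show ?thesis using True by simp
next
  case False
  then have "C > 0" using C by simp
  \<comment> \<open>The minimiser of the parabola, where its value is
    \<open>A - B^2 / C\<close>.\<close>
  then show ?thesis using nonneg[of "- B / C"] by (simp add: field_simps power2_eq_square)
qed

lemma linear_form_on_add:
  "linear_form_on V r \<Longrightarrow> v \<in> V \<Longrightarrow> w \<in> V \<Longrightarrow> r (v + w) = r v + r w"
  by (simp add: linear_form_on_def)

lemma linear_form_on_scale:
  "linear_form_on V r \<Longrightarrow> v \<in> V \<Longrightarrow> r (\<lambda>x. c * v x) = c * r v"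
  by (simp add: linear_form_on_def)

lemma linear_form_on_diff:
  assumes "fun_space.subspace V" "linear_form_on V r" "v \<in> V" "w \<in> V"
  shows "r (v - w) = r v - r w"
  using linear_form_on_add[OF assms(2) fun_space.subspace_diff[OF assms(1,3,4)] assms(4)] by simp

lemma linear_form_on_zero:
  assumes "fun_space.subspace V" "linear_form_on V r"
  shows "r 0 = 0"
  using linear_form_on_diff[OF assms fun_space.subspace_0[OF assms(1)] fun_space.subspace_0[OF assms(1)]]
  by simp

lemma linear_form_on_subset: "linear_form_on V r \<Longrightarrow> W \<subseteq> V \<Longrightarrow> linear_form_on W r"
  unfolding linear_form_on_def by blast

lemma bilinear_form_on_left: "bilinear_form_on V b \<Longrightarrow> v \<in> V \<Longrightarrow> linear_form_on V (\<lambda>w. b w v)"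
  and bilinear_form_on_right: "bilinear_form_on V b \<Longrightarrow> w \<in> V \<Longrightarrow> linear_form_on V (b w)"
  by (auto simp: bilinear_form_on_def)

lemma bilinear_form_on_subset: "bilinear_form_on V b \<Longrightarrow> W \<subseteq> V \<Longrightarrow> bilinear_form_on W b"
  unfolding bilinear_form_on_def by (blast intro: linear_form_on_subset)

lemma symmetric_form_expand:
  assumes V: "fun_space.subspace V" and b: "bilinear_form_on V b"
    and sym: "\<And>v w. v \<in> V \<Longrightarrow> w \<in> V \<Longrightarrow> b v w = b w v"
    and vw: "v \<in> V" "w \<in> V"
  shows "b (v + (\<lambda>x. t * w x)) (v + (\<lambda>x. t * w x)) = b v v + 2 * t * b v w + t\<^sup>2 * b w w"
proof -
  let ?tw = "\<lambda>x. t * w x"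
  have tw: "?tw \<in> V" using fun_space.subspace_scale[OF V vw(2)] .
  have vtw: "v + ?tw \<in> V" using fun_space.subspace_add[OF V vw(1) tw] .
  show ?thesis
    using linear_form_on_add[OF bilinear_form_on_left[OF b vtw] vw(1) tw]
      linear_form_on_add[OF bilinear_form_on_right[OF b vw(1)] vw(1) tw]
      linear_form_on_add[OF bilinear_form_on_right[OF b vw(2)] vw(1) tw]
      linear_form_on_scale[OF bilinear_form_on_left[OF b vtw] vw(2), of t]
      linear_form_on_scale[OF bilinear_form_on_right[OF b vw(1)] vw(2), of t]
      linear_form_on_scale[OF bilinear_form_on_right[OF b vw(2)] vw(2), of t] sym[OF vw]
    by (simp add: algebra_simps power2_eq_square)
qed

text \<open>Only semidefiniteness is assumed, because a function vanishing almost everywhere has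
  norm zero without being the zero function. The discriminant of t \<mapsto> b(v + t w, v + t w)
  settles the case \<open>b w w = 0\<close> as well.\<close>

lemma Cauchy_Schwarz_ip_norm:
  assumes V: "fun_space.subspace V" and b: "bilinear_form_on V b"
    and sym: "\<And>v w. v \<in> V \<Longrightarrow> w \<in> V \<Longrightarrow> b v w = b w v"
    and psd: "\<And>v. v \<in> V \<Longrightarrow> 0 \<le> b v v"
    and vw: "v \<in> V" "w \<in> V"
  shows "\<bar>b v w\<bar> \<le> ip_norm b v * ip_norm b w"
proof -
  have "(b v w)\<^sup>2 \<le> b v v * b w w"
  proof (rule discriminant_nonneg_quadratic[OF psd[OF vw(2)]])
    fix t :: real
    have "0 \<le> b (v + (\<lambda>x. t * w x)) (v + (\<lambda>x. t * w x))"
      by (intro psd fun_space.subspace_add[OF V] fun_space.subspace_scale[OF V] vw)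
    then show "0 \<le> b v v + 2 * t * b v w + t\<^sup>2 * b w w"
      by (simp only: symmetric_form_expand[OF V b sym vw])
  qed
  then have "\<bar>b v w\<bar> \<le> sqrt (b v v * b w w)" by (rule real_le_rsqrt[OF ord_eq_le_trans[OF power2_abs]])
  then show ?thesis by (simp add: ip_norm_def real_sqrt_mult)
qed

text \<open>The observation product lives on a whole type rather than on a carrier set of functions,
  so the expansion and the Cauchy-Schwarz inequality are given again in terms of
  \<open>bilinear\<close>.\<close>

lemma bilinear_expand:
  assumes ip: "bilinear ip" and sym: "\<And>s t. ip s t = ip t s"
  shows "ip (v + t *\<^sub>R w) (v + t *\<^sub>R w) = ip v v + 2 * t * ip v w + t\<^sup>2 * (ip w w :: real)"
  using sym[of w v]
  by (simp add: bilinear_ladd[OF ip] bilinear_radd[OF ip] bilinear_lmul[OF ip] bilinear_rmul[OF ip]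
      algebra_simps power2_eq_square)

lemma Cauchy_Schwarz_bilinear:
  assumes ip: "bilinear ip" and sym: "\<And>s t. ip s t = ip t s"
    and psd: "\<And>s. 0 \<le> (ip s s :: real)"
  shows "\<bar>ip v w\<bar> \<le> ip_norm ip v * ip_norm ip w"
proof -
  have "(ip v w)\<^sup>2 \<le> ip v v * ip w w"
  proof (rule discriminant_nonneg_quadratic[OF psd])
    show "0 \<le> ip v v + 2 * t * ip v w + t\<^sup>2 * ip w w" for t
      using psd[of "v + t *\<^sub>R w"] by (simp only: bilinear_expand[OF ip sym])
  qed
  then have "\<bar>ip v w\<bar> \<le> sqrt (ip v v * ip w w)" by (rule real_le_rsqrt[OF ord_eq_le_trans[OF power2_abs]])
  then show ?thesis by (simp add: ip_norm_def real_sqrt_mult)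
qed

lemma ip_norm_power2: "0 \<le> ip v v \<Longrightarrow> (ip_norm ip v)\<^sup>2 = ip v v"
  by (simp add: ip_norm_def)

section \<open>The space of square-integrable functions\<close>

lemma L2_mult_integrable:
  assumes "f \<in> L2 \<Omega>" "g \<in> L2 \<Omega>"
  shows "integrable (lebesgue_on \<Omega>) (\<lambda>x. f x * g x)"
proof (rule Bochner_Integration.integrable_bound)
  show "integrable (lebesgue_on \<Omega>) (\<lambda>x. (f x)\<^sup>2 + (g x)\<^sup>2)"
    using assms by (auto simp: L2_def)
  show "(\<lambda>x. f x * g x) \<in> borel_measurable (lebesgue_on \<Omega>)"
    using assms by (auto simp: L2_def)
  \<comment> \<open>Young's inequality makes the sum of the two squares an integrable majorant of
    the product.\<close>
  have "\<bar>s * t\<bar> \<le> \<bar>s\<^sup>2 + t\<^sup>2\<bar>" for s t :: real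
  proof -
    have "2 * (\<bar>s\<bar> * \<bar>t\<bar>) \<le> s\<^sup>2 + t\<^sup>2"
      using sum_squares_bound[of "\<bar>s\<bar>" "\<bar>t\<bar>"] by simp
    moreover have "0 \<le> \<bar>s\<bar> * \<bar>t\<bar>" by simp
    ultimately have "\<bar>s\<bar> * \<bar>t\<bar> \<le> s\<^sup>2 + t\<^sup>2" by linarith
    then show ?thesis by (simp add: abs_mult)
  qed
  then show "AE x in lebesgue_on \<Omega>. norm (f x * g x) \<le> norm ((f x)\<^sup>2 + (g x)\<^sup>2)" by simp
qed

lemma subspace_L2: "fun_space.subspace (L2 \<Omega>)"
proof (rule fun_space.subspaceI)
  show "0 \<in> L2 \<Omega>" by (simp add: L2_def zero_fun_def)
  fix f g assume fg: "f \<in> L2 \<Omega>" "g \<in> L2 \<Omega>"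
  have "integrable (lebesgue_on \<Omega>) (\<lambda>x. f x * f x + 2 * (f x * g x) + g x * g x)"
    by (intro Bochner_Integration.integrable_add integrable_mult_right L2_mult_integrable fg)
  then show "f + g \<in> L2 \<Omega>"
    using fg by (auto simp: L2_def plus_fun_def power2_eq_square algebra_simps)
  show "(\<lambda>x. c * f x) \<in> L2 \<Omega>" for c
    using fg by (auto simp: L2_def power_mult_distrib)
qed

lemma bilinear_L2_inner: "bilinear_form_on (L2 \<Omega>) (L2_inner \<Omega>)"
  unfolding bilinear_form_on_def linear_form_on_def L2_inner_def
  by (auto simp: plus_fun_def ring_distribs L2_mult_integrable mult.assoc mult.left_commute)

lemma L2_inner_commute: "L2_inner \<Omega> f g = L2_inner \<Omega> g f"
  by (simp add: L2_inner_def mult.commute)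

lemma L2_inner_self_nonneg: "0 \<le> L2_inner \<Omega> f f"
  by (simp add: L2_inner_def)

lemma L2_Cauchy_Schwarz:
  assumes "f \<in> L2 \<Omega>" "g \<in> L2 \<Omega>"
  shows "\<bar>L2_inner \<Omega> f g\<bar> \<le> ip_norm (L2_inner \<Omega>) f * ip_norm (L2_inner \<Omega>) g"
  by (rule Cauchy_Schwarz_ip_norm[OF subspace_L2 bilinear_L2_inner L2_inner_commute
        L2_inner_self_nonneg assms])

lemma L2_norm_le_H1_norm: "ip_norm (L2_inner \<Omega>) v \<le> H1_norm \<Omega> v"
  by (simp add: ip_norm_def H1_norm_def sum_nonneg L2_inner_self_nonneg)

section \<open>Dual norms, coercivity constants and continuous forms\<close>

lemma dual_norm_bound:
  assumes V: "fun_space.subspace V" and r: "continuous_linear_form V nrm r"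
    and nrm: "\<And>v. v \<in> V \<Longrightarrow> 0 \<le> nrm v" and v: "v \<in> V"
  shows "r v \<le> dual_norm V nrm r * nrm v"
proof -
  obtain M where M: "\<And>v. v \<in> V \<Longrightarrow> \<bar>r v\<bar> \<le> M * nrm v" and lin: "linear_form_on V r"
    using r by (auto simp: continuous_linear_form_def)
  show ?thesis
  \<comment> \<open>Elements of norm zero are outside the supremum, but continuity makes
    \<open>r\<close> vanish on them. For the others, the continuity constant \<open>M\<close> bounds
    the quotients, so that the real-valued \<open>SUP\<close> is a genuine supremum.\<close>
  proof (cases "nrm v = 0")
    case True
    then show ?thesis using M[OF v] by simp
  next
    case False
    then have pos: "nrm v > 0" using nrm[OF v] by simp
    have bdd: "bdd_above ((\<lambda>v. r v / nrm v) ` {v \<in> V. nrm v \<noteq> 0})"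
    proof (rule bdd_aboveI2)
      fix w assume "w \<in> {v \<in> V. nrm v \<noteq> 0}"
      then show "r w / nrm w \<le> M"
        using M[of w] nrm[of w] by (auto simp: divide_le_eq)
    qed
    have "r v / nrm v \<le> dual_norm V nrm r"
      unfolding dual_norm_def by (rule cSUP_upper[OF _ bdd]) (use v False in auto)
    then show ?thesis using pos by (simp add: divide_le_eq)
  qed
qed

text \<open>As for the dual norm, continuity does two things: it bounds the quotients from below by
  \<open>- M\<close>, which makes the infimum genuine, and it forces \<open>b v v = 0\<close> when
  \<open>v\<close> has norm zero.\<close>

lemma coercivity_constant_bound:
  assumes b: "continuous_bilinear_form V nrm b"
    and nrm: "\<And>v. v \<in> V \<Longrightarrow> 0 \<le> nrm v" and v: "v \<in> V"
  shows "coercivity_constant V nrm b * (nrm v)\<^sup>2 \<le> b v v"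
proof -
  obtain M where M: "\<And>v w. v \<in> V \<Longrightarrow> w \<in> V \<Longrightarrow> \<bar>b v w\<bar> \<le> M * nrm v * nrm w"
    using b by (auto simp: continuous_bilinear_form_def)
  show ?thesis
  proof (cases "nrm v = 0")
    case True
    then show ?thesis using M[OF v v] by simp
  next
    case False
    have bdd: "bdd_below ((\<lambda>v. b v v / (nrm v)\<^sup>2) ` {v \<in> V. nrm v \<noteq> 0})"
    proof (rule bdd_belowI2)
      fix w assume w: "w \<in> {v \<in> V. nrm v \<noteq> 0}"
      then have "- M * (nrm w)\<^sup>2 \<le> b w w" using M[of w w] by (simp add: power2_eq_square)
      then show "- M \<le> b w w / (nrm w)\<^sup>2" using w by (simp add: le_divide_eq)
    qed
    have "coercivity_constant V nrm b \<le> b v v / (nrm v)\<^sup>2"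
      unfolding coercivity_constant_def by (rule cINF_lower[OF bdd]) (use v False in auto)
    then show ?thesis using False by (simp add: le_divide_eq)
  qed
qed

lemma continuous_linear_form_diff:
  assumes "continuous_linear_form V nrm r" "continuous_linear_form V nrm s"
  shows "continuous_linear_form V nrm (\<lambda>v. r v - s v)"
proof -
  obtain M N where M: "\<And>v. v \<in> V \<Longrightarrow> \<bar>r v\<bar> \<le> M * nrm v" and N: "\<And>v. v \<in> V \<Longrightarrow> \<bar>s v\<bar> \<le> N * nrm v"
    using assms by (auto simp: continuous_linear_form_def)
  have "\<bar>r v - s v\<bar> \<le> (M + N) * nrm v" if "v \<in> V" for v
    using M[OF that] N[OF that] by (simp add: algebra_simps)
  moreover have "linear_form_on V (\<lambda>v. r v - s v)"
    using assms by (simp add: continuous_linear_form_def linear_form_on_def algebra_simps)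
  ultimately show ?thesis unfolding continuous_linear_form_def by blast
qed

lemma continuous_linear_form_scale:
  assumes "continuous_linear_form V nrm r"
  shows "continuous_linear_form V nrm (\<lambda>v. c * r v)"
proof -
  obtain M where M: "\<And>v. v \<in> V \<Longrightarrow> \<bar>r v\<bar> \<le> M * nrm v"
    using assms by (auto simp: continuous_linear_form_def)
  have "\<bar>c * r v\<bar> \<le> (\<bar>c\<bar> * M) * nrm v" if "v \<in> V" for v
    using M[OF that] by (simp add: abs_mult mult.assoc mult_left_mono)
  moreover have "linear_form_on V (\<lambda>v. c * r v)"
    using assms by (simp add: continuous_linear_form_def linear_form_on_def algebra_simps)
  ultimately show ?thesis unfolding continuous_linear_form_def by blast
qed

lemma continuous_bilinear_form_left:
    "continuous_bilinear_form V nrm b \<Longrightarrow> v \<in> V \<Longrightarrow> continuous_linear_form V nrm (\<lambda>w. b w v)" (is "?b \<Longrightarrow> ?v \<Longrightarrow> ?l")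
  and continuous_bilinear_form_right:
    "continuous_bilinear_form V nrm b \<Longrightarrow> v \<in> V \<Longrightarrow> continuous_linear_form V nrm (b v)" (is "_ \<Longrightarrow> _ \<Longrightarrow> ?r")
proof -
  assume b: ?b and v: ?v
  obtain M where M: "\<And>v w. v \<in> V \<Longrightarrow> w \<in> V \<Longrightarrow> \<bar>b v w\<bar> \<le> M * nrm v * nrm w"
    using b by (auto simp: continuous_bilinear_form_def)
  have "\<bar>b w v\<bar> \<le> (M * nrm v) * nrm w" "\<bar>b v w\<bar> \<le> (M * nrm v) * nrm w" if "w \<in> V" for w
    using M[OF that v] M[OF v that] by (simp_all add: ac_simps)
  moreover have "linear_form_on V (\<lambda>w. b w v)" "linear_form_on V (b v)"
    using b v by (auto simp: continuous_bilinear_form_def bilinear_form_on_def)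
  ultimately show ?l ?r unfolding continuous_linear_form_def by blast+
qed

section \<open>Galerkin solvability without symmetry or linear independence\<close>

text \<open>Adjoining one basis element at a time needs no linear independence: if the adjoined direction,
  made orthogonal to the previous span, has zero energy, then it is in the kernel of all forms.\<close>

lemma galerkin_solution_span:
  assumes V: "fun_space.subspace V" and b: "bilinear_form_on V b"
    and null: "\<And>v w. v \<in> V \<Longrightarrow> w \<in> V \<Longrightarrow> b v v = 0 \<Longrightarrow> b w v = 0"
    and B: "finite B" "B \<subseteq> V"
    and l: "linear_form_on V l" "\<And>v. v \<in> V \<Longrightarrow> b v v = 0 \<Longrightarrow> l v = 0"
  shows "\<exists>y\<in>fun_space.span B. \<forall>v\<in>fun_space.span B. b y v = l v"
  using B l
\<comment> \<open>The functional is generalised because the induction hypothesis is used for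
  \<open>l\<close> and also for \<open>b g\<close>.\<close>
proof (induction B arbitrary: l rule: finite_induct)
  case empty
  then show ?case
    using linear_form_on_zero[OF V bilinear_form_on_right[OF b fun_space.subspace_0[OF V]]]
      linear_form_on_zero[OF V empty(2)] by (simp add: zero_fun_def)
next
  case (insert g B)
  let ?S = "fun_space.span B"
  have g: "g \<in> V" and BV: "B \<subseteq> V" using insert.prems by auto
  have SV: "?S \<subseteq> V" using BV V by (rule fun_space.span_minimal)
  have sub: "?S \<subseteq> fun_space.span (insert g B)" by (rule fun_space.span_mono) auto
  \<comment> \<open>\<open>g'\<close> is the Galerkin projection of the new generator onto the old
    span. As \<open>b\<close> need not be symmetric, \<open>g0 = g - g'\<close> is orthogonal to the
    span only in the first argument of \<open>b\<close>; this is why \<open>b y0 g0\<close> survives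
    in \<open>t\<close> below.\<close>
  obtain g' where g': "g' \<in> ?S" "\<And>v. v \<in> ?S \<Longrightarrow> b g' v = b g v"
    using insert.IH[OF BV bilinear_form_on_right[OF b g] null[OF _ g]] by blast
  define g0 where "g0 = g - g'"
  have g'V: "g' \<in> V" using g'(1) SV by auto
  have g0: "g0 \<in> V" unfolding g0_def using fun_space.subspace_diff[OF V g g'V] .
  have g0S: "g0 \<in> fun_space.span (insert g B)"
    unfolding g0_def using g'(1) sub
    by (intro fun_space.span_diff) (auto intro: fun_space.span_base)
  have orth: "b g0 v = 0" if "v \<in> ?S" for v
    using linear_form_on_diff[OF V bilinear_form_on_left[OF b] g g'V, of v] g'(2)[OF that] that SV
    by (auto simp: g0_def)
  obtain y0 where y0: "y0 \<in> ?S" "\<And>v. v \<in> ?S \<Longrightarrow> b y0 v = l v"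
    using insert.IH[OF BV insert.prems(2,3)] by blast
  have y0V: "y0 \<in> V" using y0(1) SV by auto
  \<comment> \<open>Chosen so that \<open>b y g0 = l g0\<close>. If \<open>b g0 g0 = 0\<close>,
    division by zero gives \<open>t = 0\<close>, and both sides of that equation vanish because
    \<open>g0\<close> is in the kernel.\<close>
  define t where "t = (l g0 - b y0 g0) / b g0 g0"
  define y where "y = y0 + (\<lambda>x. t * g0 x)"
  have tg0: "(\<lambda>x. t * g0 x) \<in> V" using fun_space.subspace_scale[OF V g0] .
  have y: "y \<in> fun_space.span (insert g B)"
    unfolding y_def using y0(1) sub
    by (intro fun_space.span_add fun_space.span_scale g0S) auto
  have by_eq: "b y v = b y0 v + t * b g0 v" if "v \<in> V" for v
    unfolding y_def
    using linear_form_on_add[OF bilinear_form_on_left[OF b that] y0V tg0]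
      linear_form_on_scale[OF bilinear_form_on_left[OF b that] g0, of t] by simp
  have yV: "y \<in> V" unfolding y_def using fun_space.subspace_add[OF V y0V tg0] .
  have bg0: "b y g0 = l g0"
  proof (cases "b g0 g0 = 0")
    case True
    then show ?thesis using null[OF g0 yV] insert.prems(3)[OF g0] by simp
  next
    case False
    then show ?thesis by (simp add: by_eq[OF g0] t_def)
  qed
  have "b y v = l v" if v: "v \<in> fun_space.span (insert g B)" for v
  proof -
    \<comment> \<open>Replacing \<open>g\<close> by \<open>g0\<close> changes \<open>v - k g\<close>
      only by a multiple of \<open>g'\<close>, which lies in the old span. So \<open>v\<close>
      splits into an old element \<open>s\<close> and a multiple of \<open>g0\<close>, and the
      equation can be checked on each.\<close>
    obtain k where "v - (\<lambda>x. k * g x) \<in> ?S" using v by (auto simp: fun_space.span_insert)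
    then have "(v - (\<lambda>x. k * g x)) + (\<lambda>x. k * g' x) \<in> ?S"
      using g'(1) by (intro fun_space.span_add fun_space.span_scale)
    moreover define s where "s = (v - (\<lambda>x. k * g x)) + (\<lambda>x. k * g' x)"
    ultimately have s: "s \<in> ?S" by simp
    have veq: "v = s + (\<lambda>x. k * g0 x)"
      by (simp add: s_def g0_def fun_eq_iff algebra_simps)
    have sV: "s \<in> V" using s SV by auto
    have kg0: "(\<lambda>x. k * g0 x) \<in> V" using fun_space.subspace_scale[OF V g0] .
    have "r v = r s + k * r g0" if "linear_form_on V r" for r
      unfolding veq using linear_form_on_add[OF that sV kg0] linear_form_on_scale[OF that g0, of k]
      by simp
    from this[OF insert.prems(2)] this[OF bilinear_form_on_right[OF b yV]]
    show ?thesis using bg0 by_eq[OF sV] orth[OF s] y0(2)[OF s] by simp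
  qed
  then show ?case using y by blast
qed

text \<open>A finite-dimensional space is spanned by \<open>B\<close> only up to functions that are
  zero almost everywhere. Such a difference has zero energy, so neither \<open>b y\<close> nor
  \<open>l\<close> sees it, and the equation extends from the span to \<open>V\<close>.\<close>

lemma galerkin_solution:
  assumes V: "fun_space.subspace V" and b: "bilinear_form_on V b"
    and null: "\<And>v w. v \<in> V \<Longrightarrow> w \<in> V \<Longrightarrow> b v v = 0 \<Longrightarrow> b w v = 0"
    and B: "finite B" "B \<subseteq> V"
    and span: "\<And>v. v \<in> V \<Longrightarrow> \<exists>w\<in>fun_space.span B. b (v - w) (v - w) = 0"
    and l: "linear_form_on V l" "\<And>v. v \<in> V \<Longrightarrow> b v v = 0 \<Longrightarrow> l v = 0"
  shows "\<exists>y\<in>V. \<forall>v\<in>V. b y v = l v"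
proof -
  have SV: "fun_space.span B \<subseteq> V" using B(2) V by (rule fun_space.span_minimal)
  obtain y where y: "y \<in> fun_space.span B" "\<And>v. v \<in> fun_space.span B \<Longrightarrow> b y v = l v"
    using galerkin_solution_span[OF V b null B l] by blast
  have yV: "y \<in> V" using y(1) SV by auto
  have "b y v = l v" if v: "v \<in> V" for v
  proof -
    obtain w where w: "w \<in> fun_space.span B" "b (v - w) (v - w) = 0" using span[OF v] by blast
    have wV: "w \<in> V" using w(1) SV by auto
    have d: "v - w \<in> V" using fun_space.subspace_diff[OF V v wV] .
    show ?thesis
      using null[OF d yV w(2)] l(2)[OF d w(2)] y(2)[OF w(1)] linear_form_on_diff[OF V l(1) v wV]
        linear_form_on_diff[OF V bilinear_form_on_right[OF b yV] v wV] by simp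
  qed
  then show ?thesis using yV by blast
qed

section \<open>Energy estimate, scalar inequalities and first variation\<close>

lemma sum_le_L2_set_mult:
  assumes "\<And>k. k \<in> A \<Longrightarrow> s k \<le> d k * n k"
  shows "(\<Sum>k\<in>A. s k) \<le> L2_set d A * L2_set n A"
proof -
  \<comment> \<open>Passing to absolute values allows factors of any sign, so dual norms can be
    inserted without a proof that they are nonnegative.\<close>
  have "(\<Sum>k\<in>A. s k) \<le> (\<Sum>k\<in>A. \<bar>d k\<bar> * \<bar>n k\<bar>)"
    using assms by (intro sum_mono) (metis abs_ge_self abs_mult order_trans)
  also have "\<dots> \<le> L2_set d A * L2_set n A" by (rule L2_set_mult_ineq)
  finally show ?thesis .
qed

text \<open>By polarisation, b(w_k - w_{k-1}, w_k) is half of |w_k|^2 - |w_{k-1}|^2 + |w_k -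
  w_{k-1}|^2. The squared increment is nonnegative and dropped; the rest telescopes, and the final
  energy is dropped too.\<close>

lemma implicit_euler_energy:
  fixes K :: nat
  assumes W: "fun_space.subspace W" and b: "bilinear_form_on W b"
    and sym: "\<And>v w. v \<in> W \<Longrightarrow> w \<in> W \<Longrightarrow> b v w = b w v"
    and psd: "\<And>v. v \<in> W \<Longrightarrow> 0 \<le> b v v"
    and w: "\<And>k. k \<le> K \<Longrightarrow> w k \<in> W"
    and step: "\<And>k. k \<in> {1..K} \<Longrightarrow> b (w k - w (k - 1)) (w k) + e k \<le> \<rho> k"
  shows "(\<Sum>k=1..K. e k) \<le> (\<Sum>k=1..K. \<rho> k) + b (w 0) (w 0) / 2"
proof -
  have *: "e k \<le> \<rho> k - (b (w k) (w k) - b (w (k - 1)) (w (k - 1))) / 2" if k: "k \<in> {1..K}" for k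
  proof -
    have "k - 1 \<le> K" using k by (auto intro: le_trans[OF diff_le_self])
    then have v: "w k \<in> W" "w (k - 1) \<in> W" using k w[of k] w[of "k - 1"] by auto
    have d: "w k - w (k - 1) \<in> W" using fun_space.subspace_diff[OF W v] .
    show ?thesis
      using psd[OF d] step[OF k] sym[OF v]
        linear_form_on_diff[OF W bilinear_form_on_left[OF b d] v]
        linear_form_on_diff[OF W bilinear_form_on_right[OF b v(1)] v]
        linear_form_on_diff[OF W bilinear_form_on_right[OF b v(2)] v]
        linear_form_on_diff[OF W bilinear_form_on_left[OF b v(1)] v]
      by (simp add: field_simps)
  qed
  have tel: "(\<Sum>k=1..K. (b (w k) (w k) - b (w (k - 1)) (w (k - 1))) / 2)
      = b (w K) (w K) / 2 - b (w 0) (w 0) / 2"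
    by (induction K) (auto simp: field_simps)
  have "(\<Sum>k=1..K. e k) \<le> (\<Sum>k=1..K. \<rho> k - (b (w k) (w k) - b (w (k - 1)) (w (k - 1))) / 2)"
    by (rule sum_mono) (rule *)
  also have "\<dots> = (\<Sum>k=1..K. \<rho> k) - (b (w K) (w K) / 2 - b (w 0) (w 0) / 2)"
    by (simp only: sum_subtractf tel)
  finally show ?thesis using psd[OF w[of K]] by simp
qed

lemma quadratic_root_bound:
  fixes x c d :: real
  assumes "x\<^sup>2 \<le> 2 * c * x + d"
  shows "x \<le> c + sqrt (c\<^sup>2 + d)"
proof -
  have "(x - c)\<^sup>2 \<le> c\<^sup>2 + d" using assms by (simp add: power2_diff mult.commute mult.left_commute)
  then have "x - c \<le> sqrt (c\<^sup>2 + d)" by (rule real_le_rsqrt)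
  then show ?thesis by simp
qed

text \<open>\<open>x\<close> stands for the control error, \<open>S\<close> for the observed state
  error, \<open>W\<close> and \<open>G\<close> for the two trajectories of the energy estimates,
  \<open>Ly\<close> and \<open>Lp\<close> for the residuals. The bounds on \<open>W\<close> and
  \<open>G\<close> are inserted into the error identity, leaving an inequality in \<open>x\<close>
  alone.\<close>

lemma control_error_arithmetic:
  fixes x S W G Ly Lp du \<gamma> \<alpha> \<tau> :: real
  assumes \<tau>: "\<tau> > 0" and \<alpha>: "\<alpha> > 0"
    and nonneg: "0 \<le> x" "0 \<le> S" "0 \<le> W" "0 \<le> G" "0 \<le> Ly" "0 \<le> Lp"
    and main: "x\<^sup>2 + \<tau> * S\<^sup>2 \<le> du * x + \<tau> * (Lp * W) + \<tau> * (S * (\<bar>\<gamma>\<bar> * G))"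
    and W: "\<tau> * (\<alpha> * W\<^sup>2) \<le> x\<^sup>2 / 2"
    and G: "\<alpha> * G\<^sup>2 \<le> Ly * G"
  shows "x\<^sup>2 \<le> (du + 1 / sqrt \<alpha> * (sqrt \<tau> * Lp)) * x + \<gamma>\<^sup>2 / (4 * \<alpha>\<^sup>2) * (sqrt \<tau> * Ly)\<^sup>2"
proof -
  \<comment> \<open>The factor 1/2 is relaxed to 1, which gives the coefficient
    \<open>1 / sqrt \<alpha>\<close> that occurs in \<open>c1\<close>.\<close>
  have "\<tau> * (\<alpha> * W\<^sup>2) \<le> x\<^sup>2" using W zero_le_power2[of x] by linarith
  then have "(sqrt \<tau> * sqrt \<alpha> * W)\<^sup>2 \<le> x\<^sup>2"
    using \<tau> \<alpha> by (simp add: power_mult_distrib mult.assoc)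
  then have "sqrt \<tau> * sqrt \<alpha> * W \<le> x" using nonneg(1) by (rule power2_le_imp_le)
  then have "sqrt \<tau> * W * sqrt \<alpha> \<le> x" by (simp only: ac_simps)
  then have "sqrt \<tau> * W \<le> x / sqrt \<alpha>" using \<alpha> by (simp add: pos_le_divide_eq)
  then have "sqrt \<tau> * W \<le> 1 / sqrt \<alpha> * x" by simp
  then have "sqrt \<tau> * Lp * (sqrt \<tau> * W) \<le> sqrt \<tau> * Lp * (1 / sqrt \<alpha> * x)"
    using \<tau> nonneg by (intro mult_left_mono) auto
  moreover have "sqrt \<tau> * Lp * (sqrt \<tau> * W) = (sqrt \<tau> * sqrt \<tau>) * (Lp * W)"
    by (simp only: ac_simps)
  moreover have "sqrt \<tau> * sqrt \<tau> = \<tau>" using \<tau> by simp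
  moreover have "sqrt \<tau> * Lp * (1 / sqrt \<alpha> * x) = 1 / sqrt \<alpha> * (sqrt \<tau> * Lp) * x"
    by (simp only: ac_simps)
  ultimately have 1: "\<tau> * (Lp * W) \<le> 1 / sqrt \<alpha> * (sqrt \<tau> * Lp) * x" by simp
  have "\<alpha> * G \<le> Ly"
  proof (cases "G = 0")
    case False
    then have "G > 0" using nonneg by simp
    then show ?thesis using G by (simp add: power2_eq_square)
  qed (use nonneg in simp)
  then have "G \<le> Ly / \<alpha>" using \<alpha> by (simp add: field_simps)
  then have "\<gamma>\<^sup>2 * G\<^sup>2 \<le> \<gamma>\<^sup>2 * (Ly / \<alpha>)\<^sup>2"
    using nonneg by (intro mult_left_mono power_mono) auto
  \<comment> \<open>Young's inequality weighted so that the square of \<open>S\<close> has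
    coefficient exactly 1: it then cancels against the observation term on the left of
    \<open>main\<close>.\<close>
  moreover have "S * (\<bar>\<gamma>\<bar> * G) \<le> S\<^sup>2 + \<gamma>\<^sup>2 * G\<^sup>2 / 4"
    using zero_le_power2[of "S - \<bar>\<gamma>\<bar> * G / 2"]
    by (simp add: power2_diff power_mult_distrib power_divide)
  ultimately have "S * (\<bar>\<gamma>\<bar> * G) \<le> S\<^sup>2 + \<gamma>\<^sup>2 * (Ly / \<alpha>)\<^sup>2 / 4" by linarith
  then have "\<tau> * (S * (\<bar>\<gamma>\<bar> * G)) \<le> \<tau> * (S\<^sup>2 + \<gamma>\<^sup>2 * (Ly / \<alpha>)\<^sup>2 / 4)"
    using \<tau> by (simp add: mult_left_mono)
  also have "\<dots> = \<tau> * S\<^sup>2 + \<gamma>\<^sup>2 / (4 * \<alpha>\<^sup>2) * (sqrt \<tau> * Ly)\<^sup>2"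
    using \<tau> by (simp add: power_mult_distrib power_divide algebra_simps)
  finally show ?thesis using main 1 unfolding distrib_right by linarith
qed

text \<open>Adding multiples of a homogeneous trajectory keeps the state equation valid, so the cost
  along the line (y + t w, u + t \<psi>) is a quadratic polynomial in \<open>t\<close> with its
  minimum at 0. Its linear coefficient must vanish.\<close>

lemma first_variation:
  assumes opt: "optimal_4dvar \<Omega> A f C ipD \<tau> K ud zd W V y u"
    and W: "fun_space.subspace W" "W \<subseteq> L2 \<Omega>" and V: "fun_space.subspace V" "V \<subseteq> L2 \<Omega>"
    and ud: "ud \<in> L2 \<Omega>" and A: "bilinear_form_on W A"
    and C: "\<And>v w. v \<in> W \<Longrightarrow> w \<in> W \<Longrightarrow> C (v + w) = C v + C w"
      "\<And>v c. v \<in> W \<Longrightarrow> C (\<lambda>x. c * v x) = c *\<^sub>R C v"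
    and ipD: "bilinear ipD" "\<And>s t. ipD s t = ipD t s" "\<And>s. 0 \<le> ipD s s"
    and \<tau>: "0 \<le> \<tau>" and \<psi>: "\<psi> \<in> V" and w: "state_equation \<Omega> A (\<lambda>_. 0) \<tau> K W w \<psi>"
  shows "L2_inner \<Omega> (u - ud) \<psi> + \<tau> * (\<Sum>k=1..K. ipD (C (y k) - zd k) (C (w k))) = 0"
    (is "?G = 0")
proof -
  let ?m = "L2_inner \<Omega>"
  let ?Q = "(?m \<psi> \<psi> + \<tau> * (\<Sum>k=1..K. ipD (C (w k)) (C (w k)))) / 2"
  have m_add: "?m (v + (\<lambda>x. t * w x)) z = ?m v z + t * ?m w z"
    if "v \<in> L2 \<Omega>" "w \<in> L2 \<Omega>" "z \<in> L2 \<Omega>" for v w z t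
    using linear_form_on_add[OF bilinear_form_on_left[OF bilinear_L2_inner that(3)] that(1)
        fun_space.subspace_scale[OF subspace_L2 that(2)], of t]
      linear_form_on_scale[OF bilinear_form_on_left[OF bilinear_L2_inner that(3)] that(2), of t]
    by simp
  have A_add: "A (v + (\<lambda>x. t * w x)) z = A v z + t * A w z"
    if "v \<in> W" "w \<in> W" "z \<in> W" for v w z t
    using linear_form_on_add[OF bilinear_form_on_left[OF A that(3)] that(1)
        fun_space.subspace_scale[OF W(1) that(2)], of t]
      linear_form_on_scale[OF bilinear_form_on_left[OF A that(3)] that(2), of t]
    by simp
  have u: "u \<in> V" and y: "state_equation \<Omega> A f \<tau> K W y u"
    and min: "\<And>y' u'. u' \<in> V \<Longrightarrow> state_equation \<Omega> A f \<tau> K W y' u' \<Longrightarrow>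
      cost \<Omega> C ipD \<tau> K ud zd y u \<le> cost \<Omega> C ipD \<tau> K ud zd y' u'"
    using opt by (auto simp: optimal_4dvar_def)
  have yW: "y k \<in> W" "w k \<in> W" if "k \<in> {1..K}" for k
    using y w that by (auto simp: state_equation_def)
  \<comment> \<open>The states at time 0 are only known to be in \<open>L2 \<Omega>\<close>; all
    later ones are in \<open>W\<close>.\<close>
  have yL: "y k \<in> L2 \<Omega>" "w k \<in> L2 \<Omega>" if "k \<le> K" for k
    using y w W(2) that by (cases k; force simp: state_equation_def)+
  have uL: "u \<in> L2 \<Omega>" "\<psi> \<in> L2 \<Omega>" using u \<psi> V(2) by auto
  have udL: "u - ud \<in> L2 \<Omega>" using fun_space.subspace_diff[OF subspace_L2 uL(1) ud] .
  \<comment> \<open>The increment of the cost is t ?G + t^2 ?Q. The discriminant bound with constant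
    term 0 turns its nonnegativity into \<open>?G = 0\<close>.\<close>
  have "(?G / 2)\<^sup>2 \<le> 0 * ?Q"
  proof (rule discriminant_nonneg_quadratic)
    show "0 \<le> ?Q" using \<tau> by (simp add: L2_inner_self_nonneg sum_nonneg ipD(3))
    fix t :: real
    define u' where "u' = u + (\<lambda>x. t * \<psi> x)"
    define y' where "y' = (\<lambda>k. y k + (\<lambda>x. t * w k x))"
    have "state_equation \<Omega> A f \<tau> K W y' u'"
      unfolding state_equation_def
    proof (intro conjI ballI)
      fix k assume k: "k \<in> {1..K}"
      show "y' k \<in> W" unfolding y'_def
        by (intro fun_space.subspace_add[OF W(1)] fun_space.subspace_scale[OF W(1)] yW k)
      fix v assume v: "v \<in> W"
      then have vL: "v \<in> L2 \<Omega>" using W(2) by auto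
      have le: "k \<le> K" "k - 1 \<le> K" using k by auto
      have yk: "?m (y k) v + \<tau> * A (y k) v = ?m (y (k - 1)) v + \<tau> * f v"
        using y k v by (simp add: state_equation_def)
      have wk: "?m (w k) v + \<tau> * A (w k) v = ?m (w (k - 1)) v"
        using w k v by (simp add: state_equation_def)
      have "?m (y' k) v + \<tau> * A (y' k) v
          = (?m (y k) v + \<tau> * A (y k) v) + t * (?m (w k) v + \<tau> * A (w k) v)"
        unfolding y'_def by (simp add: m_add[OF yL[OF le(1)] vL] A_add[OF yW[OF k] v] algebra_simps)
      then show "?m (y' k) v + \<tau> * A (y' k) v = ?m (y' (k - 1)) v + \<tau> * f v"
        unfolding yk wk y'_def m_add[OF yL[OF le(2)] vL] by simp
    next
      show "y' 0 \<in> L2 \<Omega>" unfolding y'_def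
        by (intro fun_space.subspace_add[OF subspace_L2] fun_space.subspace_scale[OF subspace_L2] yL) auto
      fix v assume v: "v \<in> W"
      then have vL: "v \<in> L2 \<Omega>" using W(2) by auto
      show "?m (y' 0) v = ?m u' v"
        using y w v unfolding y'_def u'_def m_add[OF yL[OF le0[of K]] vL] m_add[OF uL vL]
        by (simp add: state_equation_def)
    qed
    moreover have "u' \<in> V" unfolding u'_def
      by (intro fun_space.subspace_add[OF V(1)] fun_space.subspace_scale[OF V(1)] u \<psi>)
    ultimately have le: "cost \<Omega> C ipD \<tau> K ud zd y u \<le> cost \<Omega> C ipD \<tau> K ud zd y' u'"
      by (rule min[rotated])
    have eq: "u' - ud = (u - ud) + (\<lambda>x. t * \<psi> x)" by (simp add: u'_def fun_eq_iff)
    have 1: "(ip_norm ?m (u' - ud))\<^sup>2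
        = (ip_norm ?m (u - ud))\<^sup>2 + 2 * t * ?m (u - ud) \<psi> + t\<^sup>2 * ?m \<psi> \<psi>"
      unfolding eq ip_norm_power2[of "L2_inner \<Omega>", OF L2_inner_self_nonneg]
      by (rule symmetric_form_expand[OF subspace_L2 bilinear_L2_inner L2_inner_commute udL uL(2)])
    have "(ip_norm ipD (C (y' k) - zd k))\<^sup>2 = (ip_norm ipD (C (y k) - zd k))\<^sup>2
        + 2 * t * ipD (C (y k) - zd k) (C (w k)) + t\<^sup>2 * ipD (C (w k)) (C (w k))"
      if k: "k \<in> {1..K}" for k
    proof -
      have eq: "C (y' k) - zd k = (C (y k) - zd k) + t *\<^sub>R C (w k)"
        unfolding y'_def using C(1)[OF yW(1)[OF k] fun_space.subspace_scale[OF W(1) yW(2)[OF k]], of t]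
          C(2)[OF yW(2)[OF k], of t] by simp
      show ?thesis
        unfolding eq ip_norm_power2[of ipD, OF ipD(3)] by (rule bilinear_expand[OF ipD(1,2)])
    qed
    then have 2: "(\<Sum>k=1..K. (ip_norm ipD (C (y' k) - zd k))\<^sup>2)
        = (\<Sum>k=1..K. (ip_norm ipD (C (y k) - zd k))\<^sup>2)
        + 2 * t * (\<Sum>k=1..K. ipD (C (y k) - zd k) (C (w k)))
        + t\<^sup>2 * (\<Sum>k=1..K. ipD (C (w k)) (C (w k)))"
      by (simp add: sum.distrib sum_distrib_left)
    show "0 \<le> 0 + 2 * t * (?G / 2) + t\<^sup>2 * ?Q"
      using le unfolding cost_def 1 2 by (simp add: field_simps)
  qed
  then show ?thesis by simp
qed

theorem proposition1:
  fixes \<Omega> :: "(real^'d) set"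
    and Ye Y U Y\<^sub>N U\<^sub>N :: "(real^'d \<Rightarrow> real) set"
    and ipY :: "(real^'d \<Rightarrow> real) \<Rightarrow> (real^'d \<Rightarrow> real) \<Rightarrow> real"
    and Dpar :: "(real^'p) set"
    and T \<tau> :: real and K :: nat
    and a :: "real^'p \<Rightarrow> (real^'d \<Rightarrow> real) \<Rightarrow> (real^'d \<Rightarrow> real) \<Rightarrow> real"
    and Qa :: nat and \<Theta> :: "nat \<Rightarrow> real^'p \<Rightarrow> real"
    and aq :: "nat \<Rightarrow> (real^'d \<Rightarrow> real) \<Rightarrow> (real^'d \<Rightarrow> real) \<Rightarrow> real"
    and \<alpha>0 :: real and \<alpha>LB :: "real^'p \<Rightarrow> real"
    and f :: "(real^'d \<Rightarrow> real) \<Rightarrow> real"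
    and ipD :: "real^'l \<Rightarrow> real^'l \<Rightarrow> real"
    and h :: "'l \<Rightarrow> (real^'d \<Rightarrow> real) \<Rightarrow> real" and C :: "(real^'d \<Rightarrow> real) \<Rightarrow> real^'l"
    and ud :: "real^'d \<Rightarrow> real" and zd :: "nat \<Rightarrow> real^'l"
    and \<mu> :: "real^'p"
    and u uN :: "real^'d \<Rightarrow> real" and y yN pN :: "nat \<Rightarrow> real^'d \<Rightarrow> real"
    and m :: "(real^'d \<Rightarrow> real) \<Rightarrow> (real^'d \<Rightarrow> real) \<Rightarrow> real"
    and normY normU :: "(real^'d \<Rightarrow> real) \<Rightarrow> real"
    and ry rp :: "nat \<Rightarrow> (real^'d \<Rightarrow> real) \<Rightarrow> real" and ru :: "(real^'d \<Rightarrow> real) \<Rightarrow> real"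
    and \<gamma>c Ry Rp c1 c2 :: real
  assumes domain: "bounded \<Omega>" "lipschitz_domain \<Omega>"
    and m_def: "m = L2_inner \<Omega>"
    and normY_def: "normY = ip_norm ipY"
    and normU_def: "normU = ip_norm (L2_inner \<Omega>)"
    and Ye: "H1_0 \<Omega> \<subseteq> Ye" "Ye \<subseteq> H1 \<Omega>" "hilbert_function_space \<Omega> Ye ipY"
      "\<exists>c>0. \<exists>c'>0. \<forall>v\<in>Ye. c * H1_norm \<Omega> v \<le> normY v \<and> normY v \<le> c' * H1_norm \<Omega> v"
    and Y: "Y \<subseteq> Ye" "finite_dim_space \<Omega> Y"
    and U: "U \<subseteq> L2 \<Omega>" "finite_dim_space \<Omega> U"
    and parameters: "compact Dpar"
    and time: "T > 0" "K \<ge> 1" "\<tau> = T / real K"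
    and a_continuous: "\<And>\<nu>. \<nu> \<in> Dpar \<Longrightarrow> continuous_bilinear_form Y normY (a \<nu>)"
    and a_affine: "\<And>\<nu> w v. \<nu> \<in> Dpar \<Longrightarrow> w \<in> Y \<Longrightarrow> v \<in> Y \<Longrightarrow>
        a \<nu> w v = (\<Sum>q=1..Qa. \<Theta> q \<nu> * aq q w v)"
      "\<And>q. q \<in> {1..Qa} \<Longrightarrow> continuous_on Dpar (\<Theta> q)"
      "\<And>q. q \<in> {1..Qa} \<Longrightarrow> continuous_bilinear_form Y normY (aq q)"
    and coercive: "0 < \<alpha>0" "\<And>\<nu>. \<nu> \<in> Dpar \<Longrightarrow> \<alpha>0 \<le> coercivity_constant Y normY (a \<nu>)"
    and lower_bound: "\<And>\<nu>. \<nu> \<in> Dpar \<Longrightarrow> \<alpha>0 \<le> \<alpha>LB \<nu>"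
      "\<And>\<nu>. \<nu> \<in> Dpar \<Longrightarrow> \<alpha>LB \<nu> \<le> coercivity_constant Y normY (a \<nu>)"
    and f: "continuous_linear_form Y normY f"
    and ipD: "bilinear ipD" "\<And>s t. ipD s t = ipD t s" "\<And>s. s \<noteq> 0 \<Longrightarrow> ipD s s > 0"
    and C: "\<And>i. continuous_linear_form Y normY (h i)" "\<And>\<phi>. C \<phi> = (\<chi> i. h i \<phi>)"
    and \<gamma>c_def: "\<gamma>c = (SUP v\<in>{v\<in>Y. normY v \<noteq> 0}. ip_norm ipD (C v) / normY v)"
    and ud: "ud \<in> U"
    and reduced_spaces: "Y\<^sub>N \<subseteq> Y" "fun_space.subspace Y\<^sub>N" "U\<^sub>N \<subseteq> U" "fun_space.subspace U\<^sub>N"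
    and \<mu>: "\<mu> \<in> Dpar"
    and FE: "optimal_4dvar \<Omega> (a \<mu>) f C ipD \<tau> K ud zd Y U y u"
    and RB: "optimal_4dvar \<Omega> (a \<mu>) f C ipD \<tau> K ud zd Y\<^sub>N U\<^sub>N yN uN"
      "optimality_system \<Omega> (a \<mu>) f C ipD \<tau> K ud zd Y\<^sub>N U\<^sub>N yN pN uN"
    and RB_initial: "\<And>\<phi>. \<phi> \<in> Y \<Longrightarrow> m (yN 0) \<phi> = m uN \<phi>"
    and ry_def: "\<And>k \<phi>. ry k \<phi> = f \<phi> - a \<mu> (yN k) \<phi> - 1/\<tau> * m (yN k - yN (k - 1)) \<phi>"
    and rp_def: "\<And>k \<phi>. rp k \<phi> =
        ipD (zd k - C (yN k)) (C \<phi>) - a \<mu> \<phi> (pN k) - 1/\<tau> * m \<phi> (pN k - pN (k + 1))"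
    and ru_def: "\<And>\<psi>. ru \<psi> = m \<psi> (pN 1) - L2_inner \<Omega> (uN - ud) \<psi>"
    and Ry_def: "Ry = sqrt (\<tau> * (\<Sum>k=1..K. (dual_norm Y normY (ry k))\<^sup>2))"
    and Rp_def: "Rp = sqrt (\<tau> * (\<Sum>k=1..K. (dual_norm Y normY (rp k))\<^sup>2))"
    and c1_def: "c1 = 1/2 * (dual_norm U normU ru + 1 / sqrt (\<alpha>LB \<mu>) * Rp)"
    and c2_def: "c2 = (sqrt 2 + 1) / \<alpha>LB \<mu> * Ry * Rp + \<gamma>c\<^sup>2 / (2 * (\<alpha>LB \<mu>)\<^sup>2) * Ry\<^sup>2"
  shows "normU (u - uN) \<le> c1 + sqrt (c1\<^sup>2 + c2)"
proof -
  let ?A = "a \<mu>" and ?\<alpha> = "\<alpha>LB \<mu>"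
  have \<tau>: "\<tau> > 0" using time by simp
  have \<alpha>: "?\<alpha> > 0" using coercive(1) lower_bound(1)[OF \<mu>] by simp

  \<comment> \<open>Norms and forms on the full-order spaces\<close>
  have Yelem: "0 \<le> ipY v v" "ipY v v = 0 \<longleftrightarrow> (AE x in lebesgue_on \<Omega>. v x = 0)" if "v \<in> Y" for v
    using Ye(3) Y(1) that by (auto simp: hilbert_function_space_def)
  have Ysub: "fun_space.subspace Y" and Usub: "fun_space.subspace U"
    using Y(2) U(2) by (auto simp: finite_dim_space_def)
  have YL: "Y \<subseteq> L2 \<Omega>" using Y(1) Ye(2) by (auto simp: H1_def)
  have nY: "0 \<le> normY v" if "v \<in> Y" for v
    using Yelem(1)[OF that] by (simp add: normY_def ip_norm_def)
  have nU: "0 \<le> normU v" for v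
    by (simp add: normU_def ip_norm_def L2_inner_self_nonneg)
  note A_cont = a_continuous[OF \<mu>]
  have A: "bilinear_form_on Y ?A" using A_cont by (simp add: continuous_bilinear_form_def)
  have m: "bilinear_form_on (L2 \<Omega>) m" unfolding m_def by (rule bilinear_L2_inner)
  have m_comm: "m v w = m w v" for v w unfolding m_def by (rule L2_inner_commute)
  have m_psd: "0 \<le> m v v" for v unfolding m_def by (rule L2_inner_self_nonneg)
  note m_left_diff = linear_form_on_diff[OF subspace_L2 bilinear_form_on_left[OF m]]
  note m_right_diff = linear_form_on_diff[OF subspace_L2 bilinear_form_on_right[OF m]]
  note A_left_diff = linear_form_on_diff[OF Ysub bilinear_form_on_left[OF A]]

  \<comment> \<open>The L2 norm is below the H1 norm, which norm equivalence bounds by a multiple of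
    \<open>normY\<close>.\<close>
  obtain cL where cL: "\<And>v. v \<in> Y \<Longrightarrow> normU v \<le> cL * normY v"
  proof -
    obtain c where c: "c > 0" "\<And>v. v \<in> Ye \<Longrightarrow> c * H1_norm \<Omega> v \<le> normY v" using Ye(4) by blast
    have "normU v \<le> 1 / c * normY v" if "v \<in> Y" for v
    proof -
      have "c * normU v \<le> normY v"
        using c L2_norm_le_H1_norm[of \<Omega> v] that Y(1) unfolding normU_def
        by (meson mult_left_mono order_trans less_imp_le subsetD)
      then show ?thesis using c(1) by (simp add: field_simps)
    qed
    then show ?thesis by (rule that)
  qed
  have m_cont_U: "continuous_linear_form U normU (m z)" if z: "z \<in> L2 \<Omega>" for z
    using linear_form_on_subset[OF bilinear_form_on_right[OF m z] U(1)] L2_Cauchy_Schwarz[OF z] U(1)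
    unfolding continuous_linear_form_def normU_def m_def by blast
  have m_cont: "continuous_linear_form Y normY (m z)" if z: "z \<in> L2 \<Omega>" for z
  proof -
    have "\<bar>m z v\<bar> \<le> (normU z * cL) * normY v" if v: "v \<in> Y" for v
      using L2_Cauchy_Schwarz[OF z, of v] YL v mult_left_mono[OF cL[OF v] nU[of z]]
      by (auto simp: m_def normU_def mult.assoc)
    then show ?thesis
      using linear_form_on_subset[OF bilinear_form_on_right[OF m z] YL]
      unfolding continuous_linear_form_def by blast
  qed
  have coer: "?\<alpha> * (normY v)\<^sup>2 \<le> ?A v v" if v: "v \<in> Y" for v
    using coercivity_constant_bound[OF A_cont nY v] mult_right_mono[OF lower_bound(2)[OF \<mu>], of "(normY v)\<^sup>2"]
    by simp

  \<comment> \<open>The observation operator\<close>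
  have ipD_psd: "0 \<le> ipD s s" for s
    using ipD(3)[of s] bilinear_lzero[OF ipD(1), of 0] by (cases "s = 0") auto
  note ipD_CS = Cauchy_Schwarz_bilinear[OF ipD(1,2) ipD_psd]
  have nD: "0 \<le> ip_norm ipD s" for s using ipD_psd by (simp add: ip_norm_def)
  have C_add: "C (v + w) = C v + C w" if "v \<in> Y" "w \<in> Y" for v w
    using C(1) that by (simp add: C(2) vec_eq_iff continuous_linear_form_def linear_form_on_def)
  have C_scale: "C (\<lambda>x. c * v x) = c *\<^sub>R C v" if "v \<in> Y" for v c
    using C(1) that by (simp add: C(2) vec_eq_iff continuous_linear_form_def linear_form_on_def)
  have C_diff: "C (v - w) = C v - C w" if "v \<in> Y" "w \<in> Y" for v w
    using C_add[OF fun_space.subspace_diff[OF Ysub that] that(2)] by simp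
  \<comment> \<open>A provisional constant from the components of \<open>C\<close>. It shows that
    the quotients defining \<open>\<gamma>c\<close> are bounded, so that their supremum is
    meaningful.\<close>
  obtain MC where MC: "\<And>v. v \<in> Y \<Longrightarrow> ip_norm ipD (C v) \<le> MC * normY v"
  proof -
    have "\<exists>M. \<forall>v\<in>Y. \<bar>h i v\<bar> \<le> M * normY v" for i
      using C(1)[of i] by (simp add: continuous_linear_form_def)
    then obtain M where M: "\<And>i v. v \<in> Y \<Longrightarrow> \<bar>h i v\<bar> \<le> M i * normY v" by metis
    obtain B where B: "B > 0" "\<And>s t. norm (ipD s t) \<le> B * norm s * norm t"
      using bilinear_bounded_pos[OF ipD(1)] by blast
    have "ip_norm ipD (C v) \<le> (sqrt B * (\<Sum>i\<in>UNIV. M i)) * normY v" if v: "v \<in> Y" for v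
    proof -
      have "norm (C v) \<le> (\<Sum>i\<in>UNIV. \<bar>C v $ i\<bar>)" by (rule norm_le_l1_cart)
      also have "\<dots> \<le> (\<Sum>i\<in>UNIV. M i * normY v)"
        using M[OF v] by (intro sum_mono) (simp add: C(2))
      finally have *: "norm (C v) \<le> (\<Sum>i\<in>UNIV. M i) * normY v" by (simp add: sum_distrib_right)
      have "ipD (C v) (C v) \<le> B * (norm (C v))\<^sup>2"
        using B(2)[of "C v" "C v"] by (simp add: power2_eq_square mult.assoc)
      then have "ip_norm ipD (C v) \<le> sqrt (B * (norm (C v))\<^sup>2)"
        unfolding ip_norm_def by (rule real_sqrt_le_mono)
      also have "\<dots> = sqrt B * norm (C v)" by (simp add: real_sqrt_mult)
      also have "\<dots> \<le> sqrt B * ((\<Sum>i\<in>UNIV. M i) * normY v)"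
        using * B(1) by (intro mult_left_mono) auto
      finally show ?thesis by (simp add: mult.assoc)
    qed
    then show ?thesis by (rule that)
  qed
  \<comment> \<open>If all elements of \<open>Y\<close> have norm zero, \<open>\<gamma>c\<close> is
    the supremum of the empty set and its sign is unknown. The absolute value is nonnegative in
    every case, and the final bound contains only the square of \<open>\<gamma>c\<close>.\<close>
  have C_bound: "ip_norm ipD (C v) \<le> \<bar>\<gamma>c\<bar> * normY v" if v: "v \<in> Y" for v
  proof (cases "normY v = 0")
    case True
    then show ?thesis using MC[OF v] by simp
  next
    case False
    have "bdd_above ((\<lambda>v. ip_norm ipD (C v) / normY v) ` {v \<in> Y. normY v \<noteq> 0})"
    proof (rule bdd_aboveI2)
      fix w assume "w \<in> {v \<in> Y. normY v \<noteq> 0}"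
      then show "ip_norm ipD (C w) / normY w \<le> MC"
        using MC[of w] nY[of w] by (auto simp: divide_le_eq)
    qed
    then have "ip_norm ipD (C v) / normY v \<le> \<gamma>c"
      unfolding \<gamma>c_def by (rule cSUP_upper[rotated]) (use v False in auto)
    then have "ip_norm ipD (C v) / normY v \<le> \<bar>\<gamma>c\<bar>" by linarith
    then show ?thesis using False nY[OF v] by (simp add: divide_le_eq)
  qed
  have ipD_cont: "continuous_linear_form Y normY (\<lambda>v. ipD s (C v))" for s
  proof -
    have "\<bar>ipD s (C v)\<bar> \<le> (ip_norm ipD s * MC) * normY v" if "v \<in> Y" for v
      using ipD_CS[of s "C v"] mult_left_mono[OF MC[OF that] nD[of s]] by (simp add: mult.assoc)
    moreover have "linear_form_on Y (\<lambda>v. ipD s (C v))"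
      by (simp add: linear_form_on_def C_add C_scale bilinear_radd[OF ipD(1)] bilinear_rmul[OF ipD(1)])
    ultimately show ?thesis unfolding continuous_linear_form_def by blast
  qed

  \<comment> \<open>The optimal solutions and the control error\<close>
  have u: "u \<in> U" and y: "state_equation \<Omega> ?A f \<tau> K Y y u"
    using FE by (auto simp: optimal_4dvar_def)
  have uN: "uN \<in> U\<^sub>N" and yN: "state_equation \<Omega> ?A f \<tau> K Y\<^sub>N yN uN"
    and pN: "\<And>k. k \<in> {1..K} \<Longrightarrow> pN k \<in> Y\<^sub>N" "pN (K + 1) = 0"
    using RB(2) by (auto simp: optimality_system_def)
  have uL: "u \<in> L2 \<Omega>" "uN \<in> L2 \<Omega>" "ud \<in> L2 \<Omega>" using u uN ud U(1) reduced_spaces(3) by auto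
  have yY: "y k \<in> Y" "yN k \<in> Y" "pN k \<in> Y" if "k \<in> {1..K}" for k
    using y yN pN(1) that reduced_spaces(1) by (auto simp: state_equation_def)
  have yL: "y k \<in> L2 \<Omega>" "yN k \<in> L2 \<Omega>" if "k \<le> K" for k
    using y yN YL yY[of k] that by (cases "k = 0"; auto simp: state_equation_def)+
  have pL: "pN k \<in> L2 \<Omega>" if "k \<in> {1..K + 1}" for k
  proof (cases "k = K + 1")
    case True
    then show ?thesis using pN(2) fun_space.subspace_0[OF subspace_L2] by simp
  next
    case False
    then show ?thesis using that yY(3)[of k] YL by auto
  qed
  define e where "e = u - uN"
  have e: "e \<in> U" unfolding e_def
    using u uN reduced_spaces(3) by (intro fun_space.subspace_diff[OF Usub]) auto
  have eL: "e \<in> L2 \<Omega>" using e U(1) by auto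

  \<comment> \<open>The homogeneous trajectory started at the control error\<close>
  have euler_step: "\<exists>w\<in>Y. \<forall>v\<in>Y. m w v + \<tau> * ?A w v = m z v" if z: "z \<in> L2 \<Omega>" for z
  proof -
    let ?b = "\<lambda>w v. m w v + \<tau> * ?A w v"
    have mY: "bilinear_form_on Y m" using bilinear_form_on_subset[OF m YL] .
    have b: "bilinear_form_on Y ?b"
      using mY A by (auto simp: bilinear_form_on_def linear_form_on_def algebra_simps)
    obtain MA where MA: "\<And>w v. w \<in> Y \<Longrightarrow> v \<in> Y \<Longrightarrow> \<bar>?A w v\<bar> \<le> MA * normY w * normY v"
      using A_cont by (auto simp: continuous_bilinear_form_def)
    have m_null: "m w v = 0" if "w \<in> L2 \<Omega>" "v \<in> Y" "normY v = 0" for w v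
      using m_cont[OF that(1)] that(2,3) by (auto simp: continuous_linear_form_def)
    have b_null: "?b w v = 0" if "w \<in> Y" "v \<in> Y" "normY v = 0" for w v
      using MA[OF that(1,2)] m_null[of w v] that YL by auto
    \<comment> \<open>Coercivity of \<open>a \<mu>\<close> and nonnegativity of \<open>m\<close>
      turn zero energy into zero \<open>normY\<close>. Continuity then makes \<open>?b\<close> and
      \<open>m z\<close> vanish, as the Galerkin lemma demands.\<close>
    have norm_null: "normY v = 0" if v: "v \<in> Y" "?b v v = 0" for v
    proof -
      have "\<tau> * (?\<alpha> * (normY v)\<^sup>2) \<le> \<tau> * ?A v v" using coer[OF v(1)] \<tau> by simp
      also have "\<dots> \<le> 0" using v(2) m_psd[of v] by linarith
      finally show ?thesis using \<tau> \<alpha> by (simp add: mult_le_0_iff)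
    qed
    obtain B where B: "finite B" "B \<subseteq> Y"
      "\<And>v. v \<in> Y \<Longrightarrow> \<exists>w\<in>fun_space.span B. AE x in lebesgue_on \<Omega>. v x = w x"
      using Y(2) by (auto simp: finite_dim_space_def)
    have BY: "fun_space.span B \<subseteq> Y" using B(2) Ysub by (rule fun_space.span_minimal)
    show ?thesis
    proof (rule galerkin_solution[OF Ysub b _ B(1,2)])
      show "?b w v = 0" if "v \<in> Y" "w \<in> Y" "?b v v = 0" for v w
        using b_null[OF that(2,1) norm_null[OF that(1,3)]] .
      show "linear_form_on Y (m z)" using m_cont[OF z] by (simp add: continuous_linear_form_def)
      show "m z v = 0" if "v \<in> Y" "?b v v = 0" for v
        using m_null[OF z that(1) norm_null[OF that]] .
      fix v assume v: "v \<in> Y"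
      obtain w where w: "w \<in> fun_space.span B" "AE x in lebesgue_on \<Omega>. v x = w x"
        using B(3)[OF v] by blast
      have d: "v - w \<in> Y" using w(1) BY by (intro fun_space.subspace_diff[OF Ysub v]) auto
      have "AE x in lebesgue_on \<Omega>. (v - w) x = 0" using w(2) by eventually_elim simp
      then have "normY (v - w) = 0" using Yelem(2)[OF d] by (simp add: normY_def ip_norm_def)
      then show "\<exists>w\<in>fun_space.span B. ?b (v - w) (v - w) = 0" using b_null[OF d d] w(1) by blast
    qed
  qed
  \<comment> \<open>Membership in \<open>Y\<close> is attached to \<open>w (Suc k)\<close> only: the
    initial value \<open>e\<close> is a control and need not lie in \<open>Y\<close>.\<close>
  have "\<exists>w. \<forall>k. (w k \<in> L2 \<Omega> \<and> (k = 0 \<longrightarrow> w k = e)) \<and>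
      (w (Suc k) \<in> Y \<and> (\<forall>v\<in>Y. m (w (Suc k)) v + \<tau> * ?A (w (Suc k)) v = m (w k) v))"
  proof (rule dependent_nat_choice)
    show "\<exists>x. x \<in> L2 \<Omega> \<and> (0 = (0::nat) \<longrightarrow> x = e)" using eL by blast
    show "\<exists>z. (z \<in> L2 \<Omega> \<and> (Suc k = 0 \<longrightarrow> z = e)) \<and> z \<in> Y \<and> (\<forall>v\<in>Y. m z v + \<tau> * ?A z v = m x v)"
      if "x \<in> L2 \<Omega> \<and> (k = 0 \<longrightarrow> x = e)" for x and k :: nat
      using euler_step[of x] that YL by blast
  qed
  then obtain w where wL: "\<And>k. w k \<in> L2 \<Omega>" and w0: "w 0 = e" and wSuc: "\<And>k. w (Suc k) \<in> Y"
    and w_step: "\<And>k v. v \<in> Y \<Longrightarrow> m (w (Suc k)) v + \<tau> * ?A (w (Suc k)) v = m (w k) v"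
    by blast
  have wY: "w k \<in> Y" if "k \<in> {1..K}" for k using wSuc[of "k - 1"] that by simp
  have w_eq: "m (w k) v + \<tau> * ?A (w k) v = m (w (k - 1)) v" if "k \<in> {1..K}" "v \<in> Y" for k v
    using w_step[OF that(2), of "k - 1"] that(1) by simp
  have w_state: "state_equation \<Omega> ?A (\<lambda>_. 0) \<tau> K Y w e"
    using wY w_eq eL w0 by (auto simp: state_equation_def m_def)
  have variation: "m (u - ud) e + \<tau> * (\<Sum>k=1..K. ipD (C (y k) - zd k) (C (w k))) = 0"
    unfolding m_def
    by (rule first_variation[OF FE Ysub YL Usub U(1) uL(3) A C_add C_scale ipD(1,2) ipD_psd
          less_imp_le[OF \<tau>] e w_state])

  \<comment> \<open>Adjoint residual identity and the remaining state error\<close>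
  have adjoint: "\<tau> * (\<Sum>k=1..K. rp k (w k)) = \<tau> * (\<Sum>k=1..K. ipD (zd k - C (yN k)) (C (w k))) - m e (pN 1)"
  proof -
    \<comment> \<open>Testing the equation of \<open>w k\<close> with \<open>pN k\<close> removes
      the elliptic term and shifts the time difference from \<open>pN\<close> to \<open>w\<close>.
      The boundary term at \<open>K\<close> vanishes since \<open>pN (K + 1) = 0\<close>; the one at
      0 is \<open>m e (pN 1)\<close>.\<close>
    let ?h = "\<lambda>k. m (w k) (pN (k + 1))"
    have step: "\<tau> * rp k (w k) = \<tau> * ipD (zd k - C (yN k)) (C (w k)) + (?h k - ?h (k - 1))"
      if k: "k \<in> {1..K}" for k
    proof -
      have "m (w k) (pN k - pN (k + 1)) = m (w k) (pN k) - m (w k) (pN (k + 1))"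
        using k by (intro m_right_diff wL pL) auto
      moreover have "?h (k - 1) = m (w (k - 1)) (pN k)" using k by simp
      moreover have "\<tau> * rp k (w k) = \<tau> * ipD (zd k - C (yN k)) (C (w k)) - \<tau> * ?A (w k) (pN k)
          - m (w k) (pN k - pN (k + 1))"
        using \<tau> by (simp add: rp_def field_simps)
      ultimately show ?thesis using w_eq[OF k yY(3)[OF k]] by linarith
    qed
    have tel: "(\<Sum>k=1..n. ?h k - ?h (k - 1)) = ?h n - ?h 0" for n :: nat
      by (induction n) auto
    have "m (w K) 0 = 0" using linear_form_on_zero[OF subspace_L2 bilinear_form_on_right[OF m wL]] .
    moreover have "\<tau> * (\<Sum>k=1..K. rp k (w k))
        = (\<Sum>k=1..K. \<tau> * ipD (zd k - C (yN k)) (C (w k)) + (?h k - ?h (k - 1)))"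
      unfolding sum_distrib_left by (rule sum.cong[OF refl step])
    ultimately show ?thesis
      using tel[of K] pN(2) w0 by (simp add: sum.distrib sum_distrib_left)
  qed

  \<comment> \<open>At time 0 the three initial states are fixed only through their products with
    \<open>Y\<close>, so their combination need not be zero as a function. By
    \<open>RB_initial\<close> those products cancel, so the value 0 is consistent when tested with
    \<open>Y\<close>; this is \<open>m_g\<close>.\<close>
  define g where "g = (\<lambda>k. if k = 0 then 0 else y k - yN k - w k)"
  have gY: "g k \<in> Y" if "k \<in> {1..K}" for k
    using that unfolding g_def
    by (auto intro!: fun_space.subspace_diff[OF Ysub] yY wY)
  have gL: "g k \<in> L2 \<Omega>" if "k \<le> K" for k
    using gY[of k] that YL fun_space.subspace_0[OF subspace_L2] by (cases "k = 0") (auto simp: g_def)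
  have m_g: "m (g k) v = m (y k) v - m (yN k) v - m (w k) v" if k: "k \<le> K" and v: "v \<in> Y" for k v
  proof -
    have vL: "v \<in> L2 \<Omega>" using v YL by auto
    have d: "y k - yN k \<in> L2 \<Omega>" using fun_space.subspace_diff[OF subspace_L2 yL[OF k]] .
    show ?thesis
    proof (cases "k = 0")
      case False
      then show ?thesis
        using m_left_diff[OF vL d wL] m_left_diff[OF vL yL[OF k]] by (simp add: g_def)
    next
      case True
      have "m (y 0) v = m u v" using y v by (simp add: state_equation_def m_def)
      moreover have "m e v = m u v - m uN v" unfolding e_def using m_left_diff[OF vL uL(1,2)] .
      moreover have "m 0 v = 0" using linear_form_on_zero[OF subspace_L2 bilinear_form_on_left[OF m vL]] .
      ultimately show ?thesis using True RB_initial[OF v] w0 by (simp add: g_def)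
    qed
  qed
  \<comment> \<open>The test function \<open>g k\<close> lies in \<open>Y\<close> but not
    necessarily in \<open>Y\<^sub>N\<close>. The terms of the reduced state are therefore collected
    in \<open>ry k\<close>, while \<open>y\<close> and \<open>w\<close> satisfy their own
    equations.\<close>
  have g_step: "m (g k - g (k - 1)) (g k) + \<tau> * ?A (g k) (g k) = \<tau> * ry k (g k)"
    if k: "k \<in> {1..K}" for k
  proof -
    let ?v = "g k"
    have v: "?v \<in> Y" using gY[OF k] .
    have vL: "?v \<in> L2 \<Omega>" using v YL by auto
    have le: "k \<le> K" "k - 1 \<le> K" using k by auto
    have "m (y k) ?v + \<tau> * ?A (y k) ?v = m (y (k - 1)) ?v + \<tau> * f ?v"
      using y k v by (simp add: state_equation_def m_def)
    moreover note w_eq[OF k v]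
    moreover have "m (g k - g (k - 1)) ?v = m (g k) ?v - m (g (k - 1)) ?v"
      using m_left_diff[OF vL gL[OF le(1)] gL[OF le(2)]] .
    moreover have "m (yN k - yN (k - 1)) ?v = m (yN k) ?v - m (yN (k - 1)) ?v"
      using m_left_diff[OF vL yL(2)[OF le(1)] yL(2)[OF le(2)]] .
    moreover have "?A (g k) ?v = ?A (y k) ?v - ?A (yN k) ?v - ?A (w k) ?v"
    proof -
      have "g k = y k - yN k - w k" using k by (simp add: g_def)
      then show ?thesis
        using A_left_diff[OF v fun_space.subspace_diff[OF Ysub yY(1,2)[OF k]] wY[OF k]]
          A_left_diff[OF v yY(1,2)[OF k]] by simp
    qed
    moreover have "\<tau> * ry k ?v = \<tau> * f ?v - \<tau> * ?A (yN k) ?v - m (yN k - yN (k - 1)) ?v"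
      using \<tau> by (simp add: ry_def field_simps)
    ultimately show ?thesis
      using m_g[OF le(1) v] m_g[OF le(2) v] by (simp only: right_diff_distrib)
  qed

  \<comment> \<open>Continuity of the residuals, for use of their dual norms\<close>
  have ry_cont: "continuous_linear_form Y normY (ry k)" if k: "k \<in> {1..K}" for k
  proof -
    have "yN k - yN (k - 1) \<in> L2 \<Omega>" using k by (intro fun_space.subspace_diff[OF subspace_L2] yL) auto
    moreover have "ry k = (\<lambda>\<phi>. f \<phi> - ?A (yN k) \<phi> - 1/\<tau> * m (yN k - yN (k - 1)) \<phi>)"
      using ry_def by blast
    ultimately show ?thesis
      by (simp only:) (intro continuous_linear_form_diff continuous_linear_form_scale f m_cont
          continuous_bilinear_form_right[OF A_cont] yY k)
  qed
  have rp_cont: "continuous_linear_form Y normY (rp k)" if k: "k \<in> {1..K}" for k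
  proof -
    have "pN k - pN (k + 1) \<in> L2 \<Omega>" using k by (intro fun_space.subspace_diff[OF subspace_L2] pL) auto
    moreover have "rp k = (\<lambda>\<phi>. ipD (zd k - C (yN k)) (C \<phi>) - ?A \<phi> (pN k) - 1/\<tau> * m (pN k - pN (k + 1)) \<phi>)"
      using rp_def m_comm by fastforce
    ultimately show ?thesis
      by (simp only:) (intro continuous_linear_form_diff continuous_linear_form_scale m_cont ipD_cont
          continuous_bilinear_form_left[OF A_cont] yY k)
  qed
  have ru_cont: "continuous_linear_form U normU ru"
  proof -
    have "ru = (\<lambda>\<psi>. m (pN 1) \<psi> - m (uN - ud) \<psi>)" using ru_def m_comm m_def by fastforce
    moreover have "uN - ud \<in> L2 \<Omega>" "pN 1 \<in> L2 \<Omega>"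
      using fun_space.subspace_diff[OF subspace_L2 uL(2,3)] pL[of 1] time(2) by auto
    ultimately show ?thesis by (simp only:) (intro continuous_linear_form_diff m_cont_U)
  qed

  \<comment> \<open>Euclidean norms over the time steps, without the weight \<open>\<tau>\<close>; a
    factor \<open>sqrt \<tau>\<close> later turns \<open>Ly\<close> and \<open>Lp\<close> into
    \<open>Ry\<close> and \<open>Rp\<close>.\<close>
  define S where "S = L2_set (\<lambda>k. ip_norm ipD (C (y k - yN k))) {1..K}"
  define W where "W = L2_set (\<lambda>k. normY (w k)) {1..K}"
  define G where "G = L2_set (\<lambda>k. normY (g k)) {1..K}"
  define Ly where "Ly = L2_set (\<lambda>k. dual_norm Y normY (ry k)) {1..K}"
  define Lp where "Lp = L2_set (\<lambda>k. dual_norm Y normY (rp k)) {1..K}"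
  define x where "x = normU e"
  define du where "du = dual_norm U normU ru"
  have x2: "x\<^sup>2 = m e e"
    unfolding x_def normU_def m_def by (rule ip_norm_power2[of "L2_inner \<Omega>", OF L2_inner_self_nonneg])
  have sq: "(L2_set F {1..K})\<^sup>2 = (\<Sum>k=1..K. (F k)\<^sup>2)" for F
    by (simp add: L2_set_def sum_nonneg)

  \<comment> \<open>Energy estimates for \<open>g\<close> and \<open>w\<close>\<close>
  have "\<tau> * (?\<alpha> * G\<^sup>2) \<le> (\<Sum>k=1..K. \<tau> * ?A (g k) (g k))"
    unfolding G_def sq sum_distrib_left using coer[OF gY] \<tau> by (intro sum_mono) simp
  also have "\<dots> \<le> (\<Sum>k=1..K. \<tau> * ry k (g k)) + m (g 0) (g 0) / 2"
    by (rule implicit_euler_energy[OF subspace_L2 m m_comm m_psd]) (fact gL eq_refl[OF g_step])+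
  also have "m (g 0) (g 0) = 0"
    using linear_form_on_zero[OF subspace_L2 bilinear_form_on_right[OF m fun_space.subspace_0[OF subspace_L2]]]
    by (simp add: g_def)
  also have "(\<Sum>k=1..K. \<tau> * ry k (g k)) + 0 / 2 = \<tau> * (\<Sum>k=1..K. ry k (g k))"
    by (simp add: sum_distrib_left)
  also have "\<dots> \<le> \<tau> * (Ly * G)"
    unfolding Ly_def G_def
    using \<tau> dual_norm_bound[OF Ysub ry_cont nY gY] by (intro mult_left_mono sum_le_L2_set_mult) auto
  finally have G_bound: "?\<alpha> * G\<^sup>2 \<le> Ly * G" using \<tau> by simp

  have "\<tau> * (?\<alpha> * W\<^sup>2) \<le> (\<Sum>k=1..K. \<tau> * ?A (w k) (w k))"
    unfolding W_def sq sum_distrib_left using coer[OF wY] \<tau> by (intro sum_mono) simp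
  also have "\<dots> \<le> (\<Sum>k=1..K. 0) + m (w 0) (w 0) / 2"
  proof (rule implicit_euler_energy[OF subspace_L2 m m_comm m_psd])
    fix k assume k: "k \<in> {1..K}"
    show "m (w k - w (k - 1)) (w k) + \<tau> * ?A (w k) (w k) \<le> 0"
      using w_eq[OF k wY[OF k]] m_left_diff[OF wL wL wL] by simp
  qed (rule wL)
  finally have W_bound: "\<tau> * (?\<alpha> * W\<^sup>2) \<le> x\<^sup>2 / 2" using w0 x2 by simp

  \<comment> \<open>The error identity\<close>
  have Cw: "ipD (C (y k) - zd k) (C (w k)) + ipD (zd k - C (yN k)) (C (w k))
      = (ip_norm ipD (C (y k - yN k)))\<^sup>2 - ipD (C (y k - yN k)) (C (g k))" if k: "k \<in> {1..K}" for k
  proof -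
    let ?e = "y k - yN k"
    have eY: "?e \<in> Y" using fun_space.subspace_diff[OF Ysub yY(1,2)[OF k]] .
    have Cg: "C (g k) = C ?e - C (w k)" using k C_diff[OF eY wY[OF k]] by (simp add: g_def)
    \<comment> \<open>The data \<open>zd k\<close> cancel in the sum of the two misfits, leaving the
      observed state error; \<open>C (w k)\<close> differs from it by
      \<open>C (g k)\<close>.\<close>
    have "ipD (C (y k) - zd k) (C (w k)) + ipD (zd k - C (yN k)) (C (w k))
        = ipD ((C (y k) - zd k) + (zd k - C (yN k))) (C (w k))"
      by (rule bilinear_ladd[OF ipD(1), symmetric])
    also have "(C (y k) - zd k) + (zd k - C (yN k)) = C ?e" using C_diff[OF yY(1,2)[OF k]] by simp
    also have "ipD (C ?e) (C (w k)) = ipD (C ?e) (C ?e) - ipD (C ?e) (C (g k))"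
      unfolding Cg by (simp add: bilinear_rsub[OF ipD(1)])
    finally show ?thesis by (simp add: ip_norm_power2 ipD_psd)
  qed
  have Cw_sum: "(\<Sum>k=1..K. ipD (C (y k) - zd k) (C (w k))) + (\<Sum>k=1..K. ipD (zd k - C (yN k)) (C (w k)))
      = S\<^sup>2 - (\<Sum>k=1..K. ipD (C (y k - yN k)) (C (g k)))"
    unfolding S_def sq sum.distrib[symmetric] sum_subtractf[symmetric] by (rule sum.cong[OF refl Cw])
  have ru_e: "ru e = m e (pN 1) - m (uN - ud) e" by (simp add: ru_def m_def)
  have "e = (u - ud) - (uN - ud)" by (simp add: e_def)
  then have "m e e = m (u - ud) e - m (uN - ud) e"
    using m_left_diff[OF eL fun_space.subspace_diff[OF subspace_L2 uL(1,3)]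
        fun_space.subspace_diff[OF subspace_L2 uL(2,3)]] by simp
  \<comment> \<open>\<open>variation\<close> rewrites the full-order part of \<open>m e e\<close>
    and \<open>ru_e\<close> the reduced part. The products \<open>m e (pN 1)\<close> from
    \<open>ru_e\<close> and \<open>adjoint\<close> cancel.\<close>
  then have identity: "x\<^sup>2 + \<tau> * S\<^sup>2 = ru e + \<tau> * (\<Sum>k=1..K. rp k (w k))
      + \<tau> * (\<Sum>k=1..K. ipD (C (y k - yN k)) (C (g k)))"
    using variation adjoint ru_e x2 arg_cong[OF Cw_sum, of "(*) \<tau>"]
    unfolding distrib_left right_diff_distrib by linarith

  \<comment> \<open>Estimating the identity and solving the quadratic inequality\<close>
  have "ru e \<le> du * x"
    unfolding du_def x_def using dual_norm_bound[OF Usub ru_cont nU e] .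
  moreover have "\<tau> * (\<Sum>k=1..K. rp k (w k)) \<le> \<tau> * (Lp * W)"
    unfolding Lp_def W_def
    using \<tau> dual_norm_bound[OF Ysub rp_cont nY wY] by (intro mult_left_mono sum_le_L2_set_mult) auto
  moreover have "\<tau> * (\<Sum>k=1..K. ipD (C (y k - yN k)) (C (g k))) \<le> \<tau> * (S * (\<bar>\<gamma>c\<bar> * G))"
  proof -
    have "ipD (C (y k - yN k)) (C (g k)) \<le> ip_norm ipD (C (y k - yN k)) * (\<bar>\<gamma>c\<bar> * normY (g k))"
      if "k \<in> {1..K}" for k
      using abs_le_D1[OF ipD_CS] mult_left_mono[OF C_bound[OF gY[OF that]] nD] by (rule order_trans)
    then have "(\<Sum>k=1..K. ipD (C (y k - yN k)) (C (g k))) \<le> S * L2_set (\<lambda>k. \<bar>\<gamma>c\<bar> * normY (g k)) {1..K}"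
      unfolding S_def by (rule sum_le_L2_set_mult)
    also have "L2_set (\<lambda>k. \<bar>\<gamma>c\<bar> * normY (g k)) {1..K} = \<bar>\<gamma>c\<bar> * G"
      unfolding G_def by (simp add: L2_set_right_distrib)
    finally show ?thesis by (rule mult_left_mono[OF _ less_imp_le[OF \<tau>]])
  qed
  ultimately have main: "x\<^sup>2 + \<tau> * S\<^sup>2 \<le> du * x + \<tau> * (Lp * W) + \<tau> * (S * (\<bar>\<gamma>c\<bar> * G))"
    using identity by linarith
  have Ry: "Ry = sqrt \<tau> * Ly" and Rp: "Rp = sqrt \<tau> * Lp"
    by (simp_all add: Ry_def Rp_def Ly_def Lp_def L2_set_def real_sqrt_mult)
  have nonneg: "0 \<le> x" "0 \<le> S" "0 \<le> W" "0 \<le> G" "0 \<le> Ly" "0 \<le> Lp"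
    unfolding x_def S_def W_def G_def Ly_def Lp_def by (auto intro: nU)
  have "x\<^sup>2 \<le> (du + 1 / sqrt ?\<alpha> * Rp) * x + \<gamma>c\<^sup>2 / (4 * ?\<alpha>\<^sup>2) * Ry\<^sup>2"
    unfolding Ry Rp by (rule control_error_arithmetic[OF \<tau> \<alpha> nonneg main W_bound G_bound])
  \<comment> \<open>The coefficient 1/4 from Young's inequality is raised to 1/2, and the
    nonnegative product of \<open>Ry\<close> and \<open>Rp\<close> is added, to reach
    \<open>c2\<close>.\<close>
  also have "\<dots> \<le> 2 * c1 * x + c2"
  proof -
    have "\<gamma>c\<^sup>2 / (4 * ?\<alpha>\<^sup>2) * Ry\<^sup>2 \<le> \<gamma>c\<^sup>2 / (2 * ?\<alpha>\<^sup>2) * Ry\<^sup>2"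
      using \<alpha> by (intro mult_right_mono divide_left_mono) auto
    moreover have "0 \<le> (sqrt 2 + 1) / ?\<alpha> * Ry * Rp"
      using \<alpha> \<tau> nonneg by (simp add: Ry Rp)
    moreover have "2 * c1 = du + 1 / sqrt ?\<alpha> * Rp" by (simp add: c1_def du_def)
    ultimately show ?thesis unfolding c2_def by simp
  qed
  finally show ?thesis
    unfolding x_def e_def[symmetric] by (rule quadratic_root_bound)
qed

end
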